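(* The Polish vector space $X=\mathbb R^\omega$ contains a linear subspace $L$ such that $$L\in\big(\mathcal{B}or_X\cap\mathcal{HT}_X\cap\mathcal{NF}_X\big)\setminus\sigma\overline{\mathcal{HM}}_X\ \subseteq\ \big(\mathcal{HN}_X\cap\mathcal{HM}_X\big)\setminus\sigma\overline{\mathcal{HN}}_X$$ (that is, $L$ belongs to the first family, and the first family is contained in the second), but $L\notin\mathcal C_X$.
   Context: All vector spaces are over $\mathbb R$; $\mathbb R^\omega$ carries the product topology. Let $X$ be a Polish vector space, i.e. a nontrivial topological vector space homeomorphic to a separable complete metric space, viewed also as a Polish Abelian group. Let $2^\omega=\{0,1\}^\omega$ be the Cantor cube. - A Borel set $A\subseteq X$ is Haar-null if there is a Borel probability measure $\mu$ on $X$ with $\mu(A+x)=0$ for all $x\in X$. $\mathcal{HN}_X$ is the family of all subsets of Borel Haar-null sets of $X$. - A Borel set $A\subseteq X$ is Haar-meager if there is a continuous map $f:2^\omega\to X$ such that $f^{-1}[A+x]$ is meager in $2^\omega$ for every $x\in X$. $\mathcal{HM}_X$ is the family of all subsets of Borel Haar-meager sets of $X$. - $\sigma\overline{\mathcal{HN}}_X$ (resp. $\sigma\overline{\mathcal{HM}}_X$) is the $\sigma$-ideal generated by closed Haar-null (resp. closed Haar-meager) sets in $X$, i.e. the family of subsets of $X$ that can be covered by countably many closed Haar-null (resp. closed Haar-meager) sets. - A set $T\subseteq 2^\omega$ is thin if for every $n\in\omega$ the restriction to $T$ of the projection $2^\omega\to 2^{\omega\setminus\{n\}}$, $x\mapsto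 x{\restriction}_{\omega\setminus\{n\}}$, is injective. A set $A\subseteq X$ is Haar-thin if there is a continuous map $f:2^\omega\to X$ such that $f^{-1}[A+x]$ is thin for every $x\in X$. $\mathcal{HT}_X$ is the family of Haar-thin sets in $X$. - A set $A\subseteq X$ is null-finite if there is a sequence $(x_n)_{n\in\omega}$ in $X$ converging to zero such that for every $x\in X$ the set $\{n\in\omega: x_n+x\in A\}$ is finite. $\mathcal{NF}_X$ is the family of null-finite sets in $X$. - $\mathcal{B}or_X$ is the family of Borel subsets of $X$. - A function $f:X\to\mathbb R$ is additive if $f(x+y)=f(x)+f(y)$ for all $x,y\in X$. $\mathcal C_X$ is the class of all sets $C\subseteq X$ such that any additive function $f:X\to\mathbb R$ is continuous whenever $f[C]$ is a bounded subset of $\mathbb R$. *)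

theory Defs
  imports
    "HOL-Analysis.Analysis"
    "HOL-Probability.Probability_Measure"
    "HOL-Library.Function_Algebras"
begin

section \<open>Polish vector spaces and the space of real sequences\<close>

text \<open>The class \<open>polish_space\<close> carries a complete metric, but every notion below depends only on
  the topology (and the algebraic structure).\<close>

class polish_vector_space = polish_space + real_vector + topological_ab_group_add +
  assumes tendsto_scaleR_Pair:
      "LIM p (nhds c \<times>\<^sub>F nhds x). fst p *\<^sub>R snd p :> nhds (c *\<^sub>R x)"
    and nontrivial: "\<exists>x. x \<noteq> 0"

text \<open>Addition on functions is pointwise by \<open>Function_Algebras\<close>, and the topology is the product
  topology.\<close>

instantiation "fun" :: (type, real_vector) real_vector
begin

definition scaleR_fun :: "real \<Rightarrow> ('a \<Rightarrow> 'b) \<Rightarrow> 'a \<Rightarrow> 'b" where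
  "scaleR_fun c f = (\<lambda>x. c *\<^sub>R f x)"

instance
  by intro_classes (auto simp: scaleR_fun_def fun_eq_iff scaleR_add_right scaleR_add_left)

end

lemma tendsto_fun_iff:
  fixes f :: "'c \<Rightarrow> 'a \<Rightarrow> 'b :: topological_space"
  shows "(f \<longlongrightarrow> l) F \<longleftrightarrow> (\<forall>i. ((\<lambda>x. f x i) \<longlongrightarrow> l i) F)"
  using limitin_componentwise[of "\<lambda>_. euclidean :: 'b topology" UNIV f l F]
  by (simp add: euclidean_product_topology flip: limitin_canonical_iff)

instance "fun" :: (type, topological_ab_group_add) topological_ab_group_add
proof
  fix a b :: "'a \<Rightarrow> 'b"
  show "((\<lambda>x. fst x + snd x) \<longlongrightarrow> a + b) (nhds a \<times>\<^sub>F nhds b)"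
    unfolding tendsto_fun_iff plus_fun_apply
    using filterlim_fst[of "nhds a" "nhds b"] filterlim_snd[of "nhds b" "nhds a"]
    by (auto simp: tendsto_fun_iff intro!: tendsto_add)
  show "(uminus \<longlongrightarrow> - a) (nhds a)"
    using filterlim_ident[of "nhds a"]
    by (auto simp: tendsto_fun_iff intro!: tendsto_minus)
qed

instance "fun" :: (countable, polish_vector_space) polish_vector_space
proof
  fix c :: real and x :: "'a \<Rightarrow> 'b"
  show "LIM p (nhds c \<times>\<^sub>F nhds x). fst p *\<^sub>R snd p :> nhds (c *\<^sub>R x)"
    unfolding tendsto_fun_iff
  proof
    fix i
    have "LIM p (nhds c \<times>\<^sub>F nhds x). (fst p, snd p i) :> nhds c \<times>\<^sub>F nhds (x i)"
      using filterlim_snd[of "nhds x" "nhds c"]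
      by (intro filterlim_Pair filterlim_fst) (simp add: tendsto_fun_iff)
    from filterlim_compose[OF tendsto_scaleR_Pair this]
    show "((\<lambda>p. (fst p *\<^sub>R snd p) i) \<longlongrightarrow> (c *\<^sub>R x) i) (nhds c \<times>\<^sub>F nhds x)"
      by (simp add: scaleR_fun_def)
  qed
next
  obtain y :: 'b where "y \<noteq> 0"
    using nontrivial by blast
  then show "\<exists>x :: 'a \<Rightarrow> 'b. x \<noteq> 0"
    by (intro exI[of _ "\<lambda>_. y"]) (auto simp: fun_eq_iff)
qed

instance real :: polish_vector_space
proof
  fix c x :: real
  show "LIM p (nhds c \<times>\<^sub>F nhds x). fst p *\<^sub>R snd p :> nhds (c *\<^sub>R x)"
    by (intro tendsto_scaleR filterlim_fst filterlim_snd)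
  show "\<exists>x :: real. x \<noteq> 0"
    by (rule exI[of _ 1]) simp
qed


section \<open>Meager and thin sets\<close>

definition nowhere_dense :: "'a :: topological_space set \<Rightarrow> bool" where
  "nowhere_dense A \<longleftrightarrow> interior (closure A) = {}"

definition meager :: "'a :: topological_space set \<Rightarrow> bool" where
  "meager A \<longleftrightarrow> (\<exists>\<F>. countable \<F> \<and> (\<forall>F\<in>\<F>. nowhere_dense F) \<and> A \<subseteq> \<Union>\<F>)"

text \<open>The Cantor cube; \<open>bool\<close> is discrete and the function space has the product topology.\<close>

type_synonym cantor = "nat \<Rightarrow> bool"

definition thin :: "cantor set \<Rightarrow> bool" where
  "thin T \<longleftrightarrow> (\<forall>n. inj_on (\<lambda>x. restrict x (UNIV - {n})) T)"


section \<open>Families of small sets\<close>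

definition translate :: "'a :: ab_group_add set \<Rightarrow> 'a \<Rightarrow> 'a set" where
  "translate A x = (\<lambda>a. a + x) ` A"

definition haar_null :: "'a :: {polish_space, topological_ab_group_add} set \<Rightarrow> bool" where
  "haar_null A \<longleftrightarrow> A \<in> sets borel \<and>
    (\<exists>\<mu> :: 'a measure. sets \<mu> = sets borel \<and> prob_space \<mu> \<and>
      (\<forall>x. emeasure \<mu> (translate A x) = 0))"

definition haar_meager :: "'a :: {polish_space, topological_ab_group_add} set \<Rightarrow> bool" where
  "haar_meager A \<longleftrightarrow> A \<in> sets borel \<and>
    (\<exists>f :: cantor \<Rightarrow> 'a. continuous_on UNIV f \<and> (\<forall>x. meager (f -` translate A x)))"

definition HN :: "'a :: {polish_space, topological_ab_group_add} set set" where
  "HN = {A. \<exists>B. haar_null B \<and> A \<subseteq> B}"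

definition HM :: "'a :: {polish_space, topological_ab_group_add} set set" where
  "HM = {A. \<exists>B. haar_meager B \<and> A \<subseteq> B}"

definition sigma_closed_HN :: "'a :: {polish_space, topological_ab_group_add} set set" where
  "sigma_closed_HN =
    {A. \<exists>\<F>. countable \<F> \<and> (\<forall>F\<in>\<F>. closed F \<and> haar_null F) \<and> A \<subseteq> \<Union>\<F>}"

definition sigma_closed_HM :: "'a :: {polish_space, topological_ab_group_add} set set" where
  "sigma_closed_HM =
    {A. \<exists>\<F>. countable \<F> \<and> (\<forall>F\<in>\<F>. closed F \<and> haar_meager F) \<and> A \<subseteq> \<Union>\<F>}"

definition HT :: "'a :: {polish_space, topological_ab_group_add} set set" where
  "HT = {A. \<exists>f :: cantor \<Rightarrow> 'a. continuous_on UNIV f \<and> (\<forall>x. thin (f -` translate A x))}"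

definition NF :: "'a :: {polish_space, topological_ab_group_add} set set" where
  "NF = {A. \<exists>u :: nat \<Rightarrow> 'a. u \<longlonglongrightarrow> 0 \<and> (\<forall>x. finite {n. u n + x \<in> A})}"

definition Bor :: "'a :: topological_space set set" where
  "Bor = sets borel"

text \<open>The qualified name avoids \<open>Sigma_Algebra.additive\<close>, which is about set functions.\<close>

definition additive_bounding :: "'a :: polish_vector_space set set" where
  "additive_bounding =
    {C. \<forall>f :: 'a \<Rightarrow> real. Modules.additive f \<longrightarrow> bounded (f ` C) \<longrightarrow> continuous_on UNIV f}"

end

theory Submission
  imports Defs "HOL-Probability.Probability_Mass_Function" "HOL-Probability.Infinite_Product_Measure"
begin

text \<open>
  \<open>L\<close> is the span of a set \<open>G\<close> of sequences \<open>x\<close>, each of which has a code \<open>b\<close>, a sequence of naturals: the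
  coordinate \<open>x m\<close> lies in an interval starting at \<open>(k!)\<^sup>2\<close>, where \<open>k\<close> is the number of the initial segment
  \<open>b 0, \<dots>, b m\<close>, and infinitely many digits of \<open>b\<close> carry good approximations of the previous coordinates
  of \<open>x\<close>. Hence \<open>b\<close> determines \<open>x\<close>, and the codes of distinct points number their initial segments
  differently from some position on. As \<open>(k!)\<^sup>2\<close> grows fast, almost every coordinate of a linear
  combination of points of \<open>G\<close> is governed by one summand. So a nonzero element of \<open>L\<close> is unbounded, whence
  \<open>L\<close> is Haar-thin and null-finite; and the dominating summand can be recovered from the combination in
  a Borel way, so that \<open>L\<close> is Borel by peeling off one summand after the other. On the other hand,
  finitely many coordinates of a point of \<open>G\<close> leave the others free in arbitrarily long intervals; by
  Baire's theorem a closed set of a countable cover of \<open>G\<close> contains, for each compact set, a translate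
  of a relatively open part of it, and is not Haar-meager. Finally \<open>L\<close> and the finitely supported
  sequences do not span the constant \<open>1\<close>, which yields a discontinuous functional that vanishes on \<open>L\<close>.

  A thin set is disjoint from its image under the flip of any digit, but the flip of a late digit hardly
  moves a measurable set or a set with the Baire property; hence Borel thin sets are null and meager.
  A closed Haar-null set of real sequences is Haar-meager because bisection of boxes gives, for
  each probability measure, a continuous map from the Cantor cube under which no cylinder has a null image.
\<close>

section \<open>Borel thin sets in the Cantor cube\<close>

text \<open>Second countability lets the product sigma-algebra on the cube be identified with the
  Borel one.\<close>

instance bool :: second_countable_topology
proof
  have "open = generate_topology (UNIV :: bool set set)"
  proof (intro ext iffI)
    show "open S" for S :: "bool set" by (rule open_discrete)
  qed (rule generate_topology.Basis, simp)
  then show "\<exists>B::bool set set. countable B \<and> open = generate_topology B"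
    using countable_finite[of "UNIV :: bool set set"] finite by blast
qed

text \<open>A basic open set of the product restricts finitely many coordinates, and these all lie
  below some \<open>n\<close>.\<close>

lemma open_nat_fun_contains_box:
  fixes U :: "(nat \<Rightarrow> 'a::topological_space) set"
  assumes "open U" "x \<in> U"
  obtains X n where "\<And>i. open (X i)" "\<And>i. x i \<in> X i" "\<And>y. (\<And>i. i < n \<Longrightarrow> y i \<in> X i) \<Longrightarrow> y \<in> U"
proof -
  have "openin (product_topology (\<lambda>_. euclidean) UNIV) U"
    using assms(1) by (simp add: euclidean_product_topology)
  from product_topology_open_contains_basis[OF this assms(2)]
  obtain X where X: "x \<in> (\<Pi>\<^sub>E i\<in>UNIV. X i)" "\<And>i. openin euclidean (X i)"
    "finite {i. X i \<noteq> topspace euclidean}" "(\<Pi>\<^sub>E i\<in>UNIV. X i) \<subseteq> U" by metis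
  from X(3) have "finite {i. X i \<noteq> UNIV}" by simp
  then obtain n where "\<forall>i\<in>{i. X i \<noteq> UNIV}. i < n"
    unfolding finite_nat_set_iff_bounded ..
  then have n: "X i \<noteq> UNIV \<Longrightarrow> i < n" for i by simp
  show ?thesis
  proof
    show "open (X i)" for i using X(2) by simp
    show "x i \<in> X i" for i using PiE_mem[OF X(1)] by simp
    fix y assume "\<And>i. i < n \<Longrightarrow> y i \<in> X i"
    then have "y i \<in> X i" for i using n[of i] by (cases "X i = UNIV") simp_all
    then have "y \<in> (\<Pi>\<^sub>E i\<in>UNIV. X i)" by (intro PiE_I) simp_all
    then show "y \<in> U" using X(4) by (rule subsetD[rotated])
  qed
qed

lemma continuous_on_fun_iff:
  fixes f :: "'a::topological_space \<Rightarrow> 'b \<Rightarrow> 'c::topological_space"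
  shows "continuous_on A f \<longleftrightarrow> (\<forall>i. continuous_on A (\<lambda>x. f x i))"
  unfolding continuous_on_def tendsto_fun_iff by (intro iffI ballI allI) simp_all

lemma mem_translate_iff: "y \<in> translate A x \<longleftrightarrow> y - x \<in> A"
proof
  assume "y - x \<in> A"
  then have "(y - x) + x \<in> translate A x" unfolding translate_def by (rule imageI)
  then show "y \<in> translate A x" by simp
qed (auto simp: translate_def)

lemma translate_eq_vimage: "translate A x = (\<lambda>y. y - x) -` A"
  by (simp add: set_eq_iff mem_translate_iff)

section \<open>Meager sets and the Baire property\<close>

lemma meagerI:
  assumes "countable F" "\<And>B. B \<in> F \<Longrightarrow> nowhere_dense B" "A \<subseteq> \<Union>F"
  shows "meager A"
  unfolding meager_def by (intro exI[of _ F] conjI ballI assms)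

lemma meagerE:
  assumes "meager A"
  obtains F where "countable F" "\<And>B. B \<in> F \<Longrightarrow> nowhere_dense B" "A \<subseteq> \<Union>F"
  using assms unfolding meager_def by (elim exE conjE) (rule that, simp_all)

lemma meager_subset: "meager B \<Longrightarrow> A \<subseteq> B \<Longrightarrow> meager A"
  by (elim meagerE, rule meagerI) (assumption, simp, erule (1) order_trans)

lemma meager_empty: "meager {}"
  by (rule meagerI[of "{}"]) simp_all

lemma nowhere_dense_imp_meager: "nowhere_dense A \<Longrightarrow> meager A"
  by (rule meagerI[of "{A}"]) simp_all

lemma meager_UN:
  assumes "countable I" "\<And>i. i \<in> I \<Longrightarrow> meager (A i)"
  shows "meager (\<Union>i\<in>I. A i)"
proof -
  have "\<forall>i\<in>I. \<exists>F. countable F \<and> (\<forall>B\<in>F. nowhere_dense B) \<and> A i \<subseteq> \<Union>F"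
    using assms(2) unfolding meager_def by simp
  from bchoice[OF this] obtain F where
    F: "\<forall>i\<in>I. countable (F i) \<and> (\<forall>B\<in>F i. nowhere_dense B) \<and> A i \<subseteq> \<Union>(F i)" ..
  show ?thesis
  proof (rule meagerI)
    show "countable (\<Union>i\<in>I. F i)" using F assms(1) by simp
    show "nowhere_dense B" if "B \<in> (\<Union>i\<in>I. F i)" for B using F that by auto
    show "(\<Union>i\<in>I. A i) \<subseteq> \<Union>(\<Union>i\<in>I. F i)"
    proof
      fix x assume "x \<in> (\<Union>i\<in>I. A i)"
      then obtain i where i: "i \<in> I" "x \<in> A i" by auto
      then have "x \<in> \<Union>(F i)" using F by (simp add: subset_eq)
      then show "x \<in> \<Union>(\<Union>i\<in>I. F i)" using i(1) by auto
    qed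
  qed
qed

lemma meager_Un: "meager A \<Longrightarrow> meager B \<Longrightarrow> meager (A \<union> B)"
  using meager_UN[of "UNIV::bool set" "\<lambda>b. if b then A else B"]
  by (simp add: UNIV_bool Un_commute split: if_splits)

lemma nowhere_dense_closure_Diff:
  assumes "open U"
  shows "nowhere_dense (closure U - U)"
proof -
  have "closed (closure U - U)" using assms by (simp add: closed_Diff)
  moreover have "interior (closure U - U) = {}"
  proof (rule ccontr)
    assume "interior (closure U - U) \<noteq> {}"
    then obtain V where V: "open V" "V \<noteq> {}" "V \<subseteq> closure U - U"
      by (meson interior_subset open_interior)
    then show False using open_Int_closure_eq_empty[of V U] by auto
  qed
  ultimately show ?thesis by (simp add: nowhere_dense_def)
qed

lemma compact_UNIV_cantor: "compact (UNIV :: cantor set)"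
proof -
  have "compact_space (euclidean :: cantor topology)"
    unfolding euclidean_product_topology[symmetric] compact_space_product_topology
    by (simp add: compact_space_def finite_imp_compact)
  then show ?thesis by (simp add: compact_space_def)
qed

text \<open>Baire's theorem for the compact Hausdorff cube, applied to the closures of the nowhere
  dense sets.\<close>

lemma open_cantor_not_meager:
  fixes U :: "cantor set"
  assumes "open U" "U \<noteq> {}"
  shows "\<not> meager U"
proof
  assume "meager U"
  then obtain F where F: "countable F" "\<And>B. B \<in> F \<Longrightarrow> nowhere_dense B" "U \<subseteq> \<Union>F"
    by (rule meagerE) simp
  have "compact_space (euclidean :: cantor topology)"
    using compact_UNIV_cantor by (simp add: compact_space_def)
  moreover have "Hausdorff_space (euclidean :: cantor topology)"
    unfolding euclidean_product_topology[symmetric] Hausdorff_space_product_topology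
  proof (intro disjI2 ballI)
    show "Hausdorff_space (euclidean :: bool topology)"
      unfolding Hausdorff_space_def
    proof (intro allI impI, elim conjE)
      fix x y :: bool assume "x \<noteq> y"
      from hausdorff[OF this]
      show "\<exists>U V. openin euclidean U \<and> openin euclidean V \<and> x \<in> U \<and> y \<in> V \<and> disjnt U V"
        by (simp add: disjnt_def)
    qed
  qed
  ultimately have lc: "locally_compact_space (euclidean :: cantor topology)"
    and rg: "regular_space (euclidean :: cantor topology)"
    by (simp_all add: compact_imp_locally_compact_space compact_Hausdorff_imp_regular_space)
  have "euclidean interior_of \<Union>(closure ` F) = {}"
  proof (rule Baire_category_alt)
    fix T assume "T \<in> closure ` F"
    then show "closedin euclidean T \<and> euclidean interior_of T = {}"
      using F(2) by (auto simp: nowhere_dense_def)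
  qed (simp_all add: lc rg F(1))
  moreover have "U \<subseteq> \<Union>(closure ` F)"
  proof
    fix x assume "x \<in> U"
    then obtain B where "B \<in> F" "x \<in> B" using F(3) by (meson UnionE subsetD)
    then show "x \<in> \<Union>(closure ` F)" using closure_subset[of B] by (intro UnionI[of "closure B"]) auto
  qed
  ultimately show False
    using assms interior_maximal[of U "\<Union>(closure ` F)"] by simp
qed

definition baire_property :: "'a::topological_space set \<Rightarrow> bool" where
  "baire_property A \<longleftrightarrow> (\<exists>U. open U \<and> meager ((A - U) \<union> (U - A)))"

lemma borel_imp_baire_property:
  assumes "A \<in> sets borel"
  shows "baire_property A"
proof -
  have "A \<in> sigma_sets UNIV {S. open S}" using assms by (simp add: borel_def)
  then show ?thesis
  proof (induction rule: sigma_sets.induct)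
    case (Basic A)
    then show ?case unfolding baire_property_def by (intro exI[of _ A]) (simp add: meager_empty)
  next
    case Empty
    show ?case unfolding baire_property_def by (intro exI[of _ "{}"]) (simp add: meager_empty)
  next
    case (Compl A)
    then obtain U where U: "open U" "meager ((A - U) \<union> (U - A))"
      unfolding baire_property_def by blast
    \<comment> \<open>The complement of \<open>A\<close> is approximated by the complement of
      \<open>closure U\<close>; the extra error is the boundary of \<open>U\<close>.\<close>
    have "meager (((A - U) \<union> (U - A)) \<union> (closure U - U))"
      by (intro meager_Un[OF U(2)] nowhere_dense_imp_meager nowhere_dense_closure_Diff U(1))
    then have "meager (((UNIV - A) - (- closure U)) \<union> ((- closure U) - (UNIV - A)))"
      by (rule meager_subset) (use closure_subset[of U] in auto)
    then show ?case unfolding baire_property_def by (meson closed_closure open_Compl)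
  next
    case (Union A)
    then have "\<forall>i. \<exists>U. open U \<and> meager ((A i - U) \<union> (U - A i))"
      unfolding baire_property_def by blast
    from choice[OF this] obtain U where U: "\<And>i. open (U i)" "\<And>i. meager ((A i - U i) \<union> (U i - A i))"
      by blast
    have "meager (\<Union>i. (A i - U i) \<union> (U i - A i))"
      by (rule meager_UN) (use U in auto)
    then have "meager ((\<Union>(range A) - \<Union>(range U)) \<union> (\<Union>(range U) - \<Union>(range A)))"
      by (rule meager_subset) auto
    then show ?case unfolding baire_property_def using U(1) by blast
  qed
qed

section \<open>Flips of single digits\<close>

definition flip :: "nat \<Rightarrow> cantor \<Rightarrow> cantor" where
  "flip n x = x(n := \<not> x n)"

lemma flip_flip [simp]: "flip n (flip n x) = x"
  by (simp add: flip_def)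

lemma flip_other: "i \<noteq> n \<Longrightarrow> flip n x i = x i"
  by (simp add: flip_def)

lemma continuous_flip: "continuous_on A (flip n)"
proof -
  have c: "continuous_on A (\<lambda>x::cantor. x i)" for i
    using continuous_on_id[of A] unfolding continuous_on_fun_iff by simp
  have "continuous_on A (\<lambda>x::cantor. \<not> x i)" for i
    using continuous_on_compose[OF c, where g = Not] by (simp add: o_def)
  with c have "continuous_on A (\<lambda>x. flip n x i)" for i
    by (cases "i = n") (simp_all add: flip_def)
  then show ?thesis unfolding continuous_on_fun_iff by blast
qed

lemma thin_Int_flip:
  assumes "thin T" "x \<in> T"
  shows "flip n x \<notin> T"
proof
  assume *: "flip n x \<in> T"
  have "restrict (flip n x) (UNIV - {n}) = restrict x (UNIV - {n})"
    by (auto simp: flip_def)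
  then have "flip n x = x" using assms * unfolding thin_def inj_on_def by metis
  then have "flip n x n = x n" by simp
  then show False by (simp add: flip_def)
qed

text \<open>\<open>flip n\<close> is a homeomorphism and its own inverse, so it preserves nowhere
  dense sets.\<close>

lemma meager_vimage_flip:
  assumes "meager A"
  shows "meager (flip n -` A)"
proof -
  have nd: "nowhere_dense (flip n -` B)" if "nowhere_dense B" for B
  proof (rule ccontr)
    assume "\<not> nowhere_dense (flip n -` B)"
    then obtain V where V: "open V" "V \<noteq> {}" "V \<subseteq> closure (flip n -` B)"
      unfolding nowhere_dense_def by (meson interior_subset open_interior)
    have "closed (flip n -` closure B)"
      by (intro closed_vimage continuous_flip) auto
    then have "closure (flip n -` B) \<subseteq> flip n -` closure B"
      by (intro closure_minimal) (use closure_subset in auto)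
    then have "flip n -` V \<subseteq> closure B" using V(3) by (auto; metis flip_flip subsetD vimageD)
    moreover have "open (flip n -` V)" by (intro open_vimage continuous_flip V)
    ultimately have "flip n -` V \<subseteq> interior (closure B)" by (simp add: interior_maximal)
    then have "flip n -` V = {}" using that by (simp add: nowhere_dense_def)
    then show False using V(2) by (metis all_not_in_conv flip_flip vimageI2)
  qed
  from assms obtain F where F: "countable F" "\<And>B. B \<in> F \<Longrightarrow> nowhere_dense B" "A \<subseteq> \<Union>F"
    by (rule meagerE) simp
  show ?thesis
  proof (rule meagerI)
    show "countable ((-`) (flip n) ` F)" using F(1) by simp
    show "nowhere_dense B" if "B \<in> (-`) (flip n) ` F" for B using that nd F(2) by auto
    show "flip n -` A \<subseteq> \<Union>((-`) (flip n) ` F)" using vimage_mono[OF F(3)] by (simp add: vimage_Union)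
  qed
qed

text \<open>If \<open>T\<close> were comeager in a nonempty open set, it would meet its own image
  under a flip that preserves a smaller open box, against thinness.\<close>

lemma thin_borel_imp_meager:
  assumes "T \<in> sets borel" "thin T"
  shows "meager T"
proof -
  obtain U where U: "open U" "meager ((T - U) \<union> (U - T))"
    using borel_imp_baire_property[OF assms(1)] unfolding baire_property_def by blast
  have "U = {}"
  proof (rule ccontr)
    assume "U \<noteq> {}"
    then obtain x where "x \<in> U" by blast
    with U(1) obtain X n where X: "\<And>i. open (X i)" "\<And>i. x i \<in> X i"
      "\<And>y. (\<And>i. i < n \<Longrightarrow> y i \<in> X i) \<Longrightarrow> y \<in> U"
      using open_nat_fun_contains_box by metis
    \<comment> \<open>Membership in \<open>V\<close> depends on coordinates below \<open>n\<close>
      only, so \<open>flip n\<close> maps \<open>V\<close> onto itself.\<close>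
    define V where "V = {y. \<forall>i<n. y i \<in> X i}"
    have "V = (\<Inter>i\<in>{..<n}. (\<lambda>y. y i) -` X i)" by (auto simp: V_def)
    moreover have "open ((\<lambda>y. y i) -` X i)" for i
      using continuous_on_id[of UNIV] X(1) unfolding continuous_on_fun_iff
      by (intro open_vimage) auto
    ultimately have V: "open V" by (simp add: open_INT)
    have "V \<subseteq> U" using X(3) by (auto simp: V_def)
    then have m: "meager (V - T)" using U(2) by (rule_tac meager_subset) auto
    have "V \<subseteq> (V - T) \<union> (flip n -` (V - T))"
    proof
      fix y assume "y \<in> V"
      moreover from this have "flip n y \<in> V" by (auto simp: V_def flip_other)
      ultimately show "y \<in> (V - T) \<union> (flip n -` (V - T))" 
        using thin_Int_flip[OF assms(2), of y n] by auto
    qed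
    then have "meager V"
      by (rule meager_subset[OF meager_Un[OF m meager_vimage_flip[OF m]]])
    moreover have "x \<in> V" using X(2) by (simp add: V_def)
    ultimately show False using open_cantor_not_meager V by blast
  qed
  then show ?thesis using U(2) by simp
qed

section \<open>The fair coin measure\<close>

definition coin :: "cantor measure" where
  "coin = (\<Pi>\<^sub>M i\<in>UNIV. measure_pmf (bernoulli_pmf (1/2)))"

interpretation coin: product_prob_space "\<lambda>_::nat. measure_pmf (bernoulli_pmf (1/2))" UNIV
  by unfold_locales

lemma prob_space_coin: "prob_space coin"
  unfolding coin_def by (rule prob_space_PiM) unfold_locales

lemma sets_coin: "sets coin = sets borel"
proof -
  have "sets coin = sets (\<Pi>\<^sub>M i\<in>UNIV. (borel :: bool measure))"
    unfolding coin_def by (intro sets_PiM_cong) (auto simp: sets_borel_eq_count_space)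
  then show ?thesis by (simp add: sets_PiM_equal_borel)
qed

lemma flip_measurable [measurable]: "flip n \<in> coin \<rightarrow>\<^sub>M coin"
  using borel_measurable_continuous_onI[OF continuous_flip]
  by (simp add: measurable_cong_sets[OF sets_coin sets_coin])

lemma map_Not_bernoulli_half: "map_pmf Not (bernoulli_pmf (1/2)) = bernoulli_pmf (1/2)"
proof -
  have "range Not = UNIV" by (auto simp: UNIV_bool)
  then show ?thesis
    unfolding bernoulli_pmf_half_conv_pmf_of_set by (subst map_pmf_of_set_inj) (auto simp: inj_on_def)
qed

text \<open>Agreement on finite-dimensional cylinders suffices; there the flip affects only the
  factor \<open>A n\<close>, and a fair coin is symmetric under \<open>Not\<close>.\<close>

lemma distr_coin_flip: "distr coin coin (flip n) = coin"
proof -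
  let ?p = "bernoulli_pmf (1/2)" and ?M = "\<lambda>_::nat. measure_pmf (bernoulli_pmf (1/2))"
  show ?thesis
  proof (rule measure_eqI_PiM_infinite[where I = UNIV and M = ?M])
    show "sets (distr coin coin (flip n)) = sets (Pi\<^sub>M UNIV ?M)"
      "sets coin = sets (Pi\<^sub>M UNIV ?M)" by (simp_all add: coin_def)
    show "finite_measure (distr coin coin (flip n))"
      using prob_space.prob_space_distr[OF prob_space_coin flip_measurable]
      by (simp add: prob_space.finite_measure)
    fix A :: "nat \<Rightarrow> bool set" and J :: "nat set" assume J: "finite J"
    define A' where "A' = A(n := Not -` A n)"
    have emb: "prod_emb UNIV ?M J (Pi\<^sub>E J C) = {x. \<forall>j\<in>J. x j \<in> C j}" for C
      by (auto simp: prod_emb_def space_PiM PiE_iff)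
    have "flip n x j \<in> A j \<longleftrightarrow> x j \<in> A' j" for x j
      by (simp add: flip_def A'_def)
    then have "flip n -` prod_emb UNIV ?M J (Pi\<^sub>E J A) \<inter> space coin = prod_emb UNIV ?M J (Pi\<^sub>E J A')"
      by (simp add: emb coin_def space_PiM PiE_UNIV_domain)
    then have "emeasure (distr coin coin (flip n)) (prod_emb UNIV ?M J (Pi\<^sub>E J A))
        = emeasure coin (prod_emb UNIV ?M J (Pi\<^sub>E J A'))"
      by (subst emeasure_distr[OF flip_measurable]) (simp_all add: coin_def sets_PiM_I J)
    also have "\<dots> = (\<Prod>j\<in>J. emeasure ?p (A' j))"
      unfolding coin_def by (subst coin.emeasure_PiM_emb) (auto simp: J)
    also have "\<dots> = (\<Prod>j\<in>J. emeasure ?p (A j))"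
    proof (rule prod.cong)
      fix j
      have "emeasure ?p (Not -` A j) = emeasure (map_pmf Not ?p) (A j)" by simp
      then show "emeasure ?p (A' j) = emeasure ?p (A j)"
        by (auto simp: A'_def map_Not_bernoulli_half simp del: emeasure_map_pmf)
    qed simp
    also have "\<dots> = emeasure coin (prod_emb UNIV ?M J (Pi\<^sub>E J A))"
      unfolding coin_def by (subst coin.emeasure_PiM_emb) (auto simp: J)
    finally show "emeasure (distr coin coin (flip n)) (prod_emb UNIV ?M J (Pi\<^sub>E J A))
      = emeasure coin (prod_emb UNIV ?M J (Pi\<^sub>E J A))" .
  qed
qed

lemma space_coin [simp]: "space coin = UNIV"
  by (simp add: coin_def space_PiM)

lemma measure_vimage_flip:
  assumes "B \<in> sets coin"
  shows "measure coin (flip n -` B) = measure coin B"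
  using measure_distr[OF flip_measurable assms, of n] by (simp add: distr_coin_flip)

text \<open>A flip of a coordinate that a cylinder does not restrict leaves the cylinder unchanged.
  The property passes to complements by invariance of the measure, and to countable unions by finite
  approximation.\<close>

lemma measure_Diff_flip_tendsto_0:
  assumes "B \<in> sets coin"
  shows "(\<lambda>n. measure coin (B - flip n -` B)) \<longlonglongrightarrow> 0"
proof -
  interpret P: prob_space coin by (rule prob_space_coin)
  let ?G = "{{f \<in> \<Pi>\<^sub>E i\<in>UNIV. space (measure_pmf (bernoulli_pmf (1/2))). f i \<in> A} |i A.
    i \<in> (UNIV::nat set) \<and> A \<in> sets (measure_pmf (bernoulli_pmf (1/2)))}"
  have eq: "sets coin = sigma_sets UNIV ?G" unfolding coin_def sets_PiM_single by simp
  have fl [measurable]: "flip n -` C \<in> sets coin" if "C \<in> sets coin" for n C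
    using measurable_sets[OF flip_measurable that] by simp
  have "B \<in> sigma_sets UNIV ?G" using assms eq by simp
  then show ?thesis
  proof (induction rule: sigma_sets.induct)
    case (Basic B)
    then obtain i A where B: "B = {f. f i \<in> A}" by auto
    have "eventually (\<lambda>n. measure coin (B - flip n -` B) = 0) sequentially"
      using eventually_gt_at_top[of i]
    proof eventually_elim
      case (elim n)
      then have "B - flip n -` B = {}" unfolding B by (auto simp: flip_other)
      then show ?case by (simp only: measure_empty)
    qed
    then show ?case by (rule tendsto_eventually)
  next
    case Empty
    show ?case by simp
  next
    case (Compl B)
    then have [measurable]: "B \<in> sets coin" using eq by simp
    have "measure coin ((UNIV - B) - flip n -` (UNIV - B)) = measure coin (B - flip n -` B)" for n
    proof -
      have "(UNIV - B) - flip n -` (UNIV - B) = flip n -` B - B" by auto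
      moreover have "measure coin (flip n -` B - B) = measure coin (flip n -` B) - measure coin (flip n -` B \<inter> B)"
        by (rule P.finite_measure_Diff') auto
      moreover have "measure coin (B - flip n -` B) = measure coin B - measure coin (B \<inter> flip n -` B)"
        by (rule P.finite_measure_Diff') auto
      ultimately show ?thesis by (simp add: measure_vimage_flip Int_commute)
    qed
    then show ?case using Compl.IH by simp
  next
    case (Union B)
    then have B [measurable]: "B i \<in> sets coin" for i using eq by simp
    define C where "C k = (\<Union>i<k. B i)" for k
    have [measurable]: "C k \<in> sets coin" for k by (simp add: C_def)
    have "(\<lambda>k. measure coin (C k)) \<longlonglongrightarrow> measure coin (\<Union>k. C k)"
      by (intro P.finite_Lim_measure_incseq) (auto simp: incseq_def C_def intro: less_le_trans)
    moreover have "(\<Union>k. C k) = (\<Union>i. B i)" by (auto simp: C_def)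
    ultimately have lim: "(\<lambda>k. measure coin (C k)) \<longlonglongrightarrow> measure coin (\<Union>i. B i)" by simp
    show ?case
    proof (rule LIMSEQ_I)
      fix r :: real assume "r > 0"
      then obtain k where k: "\<bar>measure coin (C k) - measure coin (\<Union>i. B i)\<bar> < r / 2"
        using LIMSEQ_D[OF lim, of "r/2"] by auto
      have "(\<lambda>n. \<Sum>i<k. measure coin (B i - flip n -` B i)) \<longlonglongrightarrow> (\<Sum>i<k. 0)"
        by (intro tendsto_sum Union.IH)
      from LIMSEQ_D[OF this, of "r/2"] \<open>r > 0\<close>
      obtain N where N: "\<And>n. n \<ge> N \<Longrightarrow> \<bar>\<Sum>i<k. measure coin (B i - flip n -` B i)\<bar> < r / 2"
        by auto
      show "\<exists>no. \<forall>n\<ge>no. norm (measure coin ((\<Union>i. B i) - flip n -` (\<Union>i. B i)) - 0) < r"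
      proof (intro exI allI impI)
        fix n assume "n \<ge> N"
        have "measure coin ((\<Union>i. B i) - flip n -` (\<Union>i. B i))
            \<le> measure coin (((\<Union>i. B i) - C k) \<union> (\<Union>i<k. B i - flip n -` B i))"
          by (rule P.finite_measure_mono) (auto simp: C_def)
        also have "\<dots> \<le> measure coin ((\<Union>i. B i) - C k) + measure coin (\<Union>i<k. B i - flip n -` B i)"
          by (rule measure_Un_le) auto
        also have "measure coin (\<Union>i<k. B i - flip n -` B i) \<le> (\<Sum>i<k. measure coin (B i - flip n -` B i))"
          by (rule measure_UNION_le) auto
        also have "measure coin ((\<Union>i. B i) - C k) = measure coin (\<Union>i. B i) - measure coin (C k)"
          by (rule P.finite_measure_Diff) (auto simp: C_def)
        finally show "norm (measure coin ((\<Union>i. B i) - flip n -` (\<Union>i. B i)) - 0) < r"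
          using k N[OF \<open>n \<ge> N\<close>] 
          unfolding real_norm_def diff_0_right abs_of_nonneg[OF measure_nonneg] by linarith
      qed
    qed
  qed
qed

text \<open>A thin set is disjoint from each of its flips, so the sequence in
  \<open>measure_Diff_flip_tendsto_0\<close> is constantly the measure of \<open>T\<close>.\<close>

lemma thin_borel_imp_null:
  assumes "T \<in> sets borel" "thin T"
  shows "emeasure coin T = 0"
proof -
  interpret P: prob_space coin by (rule prob_space_coin)
  have "T - flip n -` T = T" for n using thin_Int_flip[OF assms(2)] by auto
  then have "measure coin T = 0"
    using measure_Diff_flip_tendsto_0[of T] assms(1) by (simp add: sets_coin LIMSEQ_const_iff)
  then show ?thesis by (simp add: P.emeasure_eq_measure)
qed

lemma translate_borel:
  fixes A :: "'a :: {polish_space, topological_ab_group_add} set"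
  assumes "A \<in> sets borel"
  shows "translate A x \<in> sets borel"
proof -
  have "(\<lambda>y. y - x) \<in> borel_measurable (borel :: 'a measure)"
    by (intro borel_measurable_continuous_onI continuous_intros)
  from measurable_sets[OF this assms] show ?thesis by (simp add: translate_eq_vimage)
qed

text \<open>The map \<open>f\<close> that witnesses Haar-thinness also witnesses Haar-meagerness,
  and the image of \<open>coin\<close> under it is the measure for Haar-nullness.\<close>

lemma Bor_HT_subset_HN_HM: "Bor \<inter> HT \<subseteq> (HN \<inter> HM :: 'a :: {polish_space, topological_ab_group_add} set set)"
proof
  fix A :: "'a set" assume "A \<in> Bor \<inter> HT"
  then obtain f :: "cantor \<Rightarrow> 'a" where A: "A \<in> sets borel" and f: "continuous_on UNIV f"
    and th: "\<And>x. thin (f -` translate A x)"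
    by (auto simp: Bor_def HT_def)
  have fm: "f \<in> borel_measurable borel" using f by (rule borel_measurable_continuous_onI)
  have fc: "f \<in> borel_measurable coin" using fm by (simp add: measurable_cong_sets[OF sets_coin refl])
  have bor: "f -` translate A x \<in> sets borel" for x
    using measurable_sets[OF fm translate_borel[OF A]] by simp
  have "haar_meager A"
    unfolding haar_meager_def using A f thin_borel_imp_meager[OF bor th] by blast
  moreover have "haar_null A"
    unfolding haar_null_def
  proof (intro conjI exI allI)
    show "sets (distr coin borel f) = sets borel" by simp
    show "prob_space (distr coin borel f)" 
      by (rule prob_space.prob_space_distr[OF prob_space_coin fc])
    show "emeasure (distr coin borel f) (translate A x) = 0" for x
      using thin_borel_imp_null[OF bor th] by (simp add: emeasure_distr[OF fc translate_borel[OF A]])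
  qed (rule A)
  ultimately show "A \<in> HN \<inter> HM" by (auto simp: HN_def HM_def)
qed

section \<open>Closed Haar-null sets of real sequences\<close>

definition box_set :: "(nat \<Rightarrow> real) \<times> (nat \<Rightarrow> real) \<Rightarrow> (nat \<Rightarrow> real) set" where
  "box_set p = {y. \<forall>i. fst p i \<le> y i \<and> y i \<le> snd p i}"

text \<open>Pair decoding takes each first component infinitely often, so every coordinate is
  bisected infinitely often.\<close>

definition split_coord :: "nat \<Rightarrow> nat" where
  "split_coord n = fst (prod_decode n)"

definition half_box :: "nat \<Rightarrow> (nat \<Rightarrow> real) \<times> (nat \<Rightarrow> real) \<Rightarrow> bool \<Rightarrow> (nat \<Rightarrow> real) \<times> (nat \<Rightarrow> real)" where
  "half_box n p b = (let i = split_coord n; m = (fst p i + snd p i) / 2 in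
     if b then ((fst p)(i := m), snd p) else (fst p, (snd p)(i := m)))"

text \<open>Both children coincide if one half is null; this keeps every box positive without shrinking the
  measure of the image of a cylinder.\<close>

definition child :: "(nat \<Rightarrow> real) measure \<Rightarrow> nat \<Rightarrow> (nat \<Rightarrow> real) \<times> (nat \<Rightarrow> real) \<Rightarrow> bool \<Rightarrow>
    (nat \<Rightarrow> real) \<times> (nat \<Rightarrow> real)" where
  "child M n p b = half_box n p
     (if emeasure M (box_set (half_box n p b)) = 0 then \<not> b else b)"

primrec box_seq :: "(nat \<Rightarrow> real) measure \<Rightarrow> (nat \<Rightarrow> real) \<times> (nat \<Rightarrow> real) \<Rightarrow> cantor \<Rightarrow> nat \<Rightarrow>
    (nat \<Rightarrow> real) \<times> (nat \<Rightarrow> real)" where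
  "box_seq M p \<xi> 0 = p"
| "box_seq M p \<xi> (Suc n) = child M n (box_seq M p \<xi> n) (\<xi> n)"

text \<open>Both halves have the same side lengths, so these depend on the depth but not on the
  branch.\<close>

primrec width :: "(nat \<Rightarrow> real) \<times> (nat \<Rightarrow> real) \<Rightarrow> nat \<Rightarrow> nat \<Rightarrow> real" where
  "width p 0 i = snd p i - fst p i"
| "width p (Suc n) i = (if split_coord n = i then width p n i / 2 else width p n i)"

lemma closed_box_set: "closed (box_set p)"
  unfolding box_set_def
  by (intro closed_Collect_all closed_Collect_conj closed_Collect_le continuous_intros) simp_all

lemma box_set_borel [measurable]: "box_set p \<in> sets borel"
  by (simp add: closed_box_set)

lemma half_box_Un:
  assumes "y \<in> box_set p"
  obtains b where "y \<in> box_set (half_box n p b)"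
proof (cases "y (split_coord n) \<le> (fst p (split_coord n) + snd p (split_coord n)) / 2")
  case True
  then have "y \<in> box_set (half_box n p False)"
    using assms by (simp add: box_set_def half_box_def Let_def)
  then show ?thesis by (rule that)
next
  case False
  then have "y \<in> box_set (half_box n p True)"
    using assms by (simp add: box_set_def half_box_def Let_def)
  then show ?thesis by (rule that)
qed

lemma half_box_width:
  "snd (half_box n p b) i - fst (half_box n p b) i =
    (if split_coord n = i then (snd p i - fst p i) / 2 else snd p i - fst p i)"
  by (auto simp: half_box_def Let_def field_simps)

lemma half_box_bounds:
  assumes "\<And>i. fst p i \<le> snd p i"
  shows "fst p i \<le> fst (half_box n p b) i" "snd (half_box n p b) i \<le> snd p i"
    "fst (half_box n p b) i \<le> snd (half_box n p b) i"
  using assms[of i] by (auto simp: half_box_def Let_def)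

lemma box_seq_width: "snd (box_seq M p \<xi> n) i - fst (box_seq M p \<xi> n) i = width p n i"
  by (induction n) (simp_all add: child_def half_box_width)

text \<open>The widths decrease to a limit \<open>l\<close>, and the stages \<open>r k\<close> that
  bisect coordinate \<open>i\<close> force \<open>l = l / 2\<close>.\<close>

lemma width_tendsto_0:
  assumes "fst p i \<le> snd p i"
  shows "(\<lambda>n. width p n i) \<longlonglongrightarrow> 0"
proof -
  have nonneg: "0 \<le> width p n i" for n using assms by (induction n) auto
  have "decseq (\<lambda>n. width p n i)" by (rule decseq_SucI) (use nonneg in auto)
  then obtain l where l: "(\<lambda>n. width p n i) \<longlonglongrightarrow> l"
    using decseq_convergent[of "\<lambda>n. width p n i" 0] nonneg by metis
  define r where "r k = prod_encode (i, k)" for k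
  have r: "strict_mono r"
  proof (rule strict_monoI_Suc)
    fix k
    have "r k \<noteq> r (Suc k)" by (simp add: r_def)
    moreover have "r k \<le> r (Suc k)" by (simp add: r_def prod_encode_def triangle_def)
    ultimately show "r k < r (Suc k)" by simp
  qed
  have "(\<lambda>k. width p (r k) i) \<longlonglongrightarrow> l" using LIMSEQ_subseq_LIMSEQ[OF l r] by (simp add: o_def)
  then have "(\<lambda>k. width p (r k) i / 2) \<longlonglongrightarrow> l / 2" by (intro tendsto_intros) auto
  moreover have "width p (Suc (r k)) i = width p (r k) i / 2" for k
    by (simp add: split_coord_def r_def)
  moreover have "(\<lambda>k. width p (Suc (r k)) i) \<longlonglongrightarrow> l"
  proof -
    have "strict_mono (\<lambda>k. Suc (r k))" using r by (simp add: strict_mono_def)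
    from LIMSEQ_subseq_LIMSEQ[OF l this] show ?thesis by (simp add: o_def)
  qed
  ultimately have "l = l / 2" by (simp only: LIMSEQ_unique)
  with l show ?thesis by simp
qed

lemma box_seq_cong:
  assumes "\<And>k. k < n \<Longrightarrow> \<xi> k = \<eta> k"
  shows "box_seq M p \<xi> n = box_seq M p \<eta> n"
  using assms by (induction n) auto

lemma finite_range_box_seq: "finite (range (\<lambda>\<xi>. box_seq M p \<xi> n))"
proof (induction n)
  case (Suc n)
  have "range (\<lambda>\<xi>. box_seq M p \<xi> (Suc n)) \<subseteq>
    (\<lambda>(q, b). child M n q b) ` (range (\<lambda>\<xi>. box_seq M p \<xi> n) \<times> UNIV)"
  proof (rule image_subsetI)
    fix \<xi>
    show "box_seq M p \<xi> (Suc n) \<in> (\<lambda>(q, b). child M n q b) ` (range (\<lambda>\<xi>. box_seq M p \<xi> n) \<times> UNIV)"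
      by (rule image_eqI[of _ _ "(box_seq M p \<xi> n, \<xi> n)"]) simp_all
  qed
  then show ?case by (rule finite_subset) (intro finite_imageI finite_cartesian_product Suc, simp)
qed (simp add: image_constant_conv)

lemma box_seq_mono:
  assumes "\<And>i. fst p i \<le> snd p i"
  shows "fst (box_seq M p \<xi> n) i \<le> snd (box_seq M p \<xi> n) i"
    and "m \<le> n \<Longrightarrow> fst (box_seq M p \<xi> m) i \<le> fst (box_seq M p \<xi> n) i"
    and "m \<le> n \<Longrightarrow> snd (box_seq M p \<xi> n) i \<le> snd (box_seq M p \<xi> m) i"
proof -
  have le: "fst (box_seq M p \<xi> n) i \<le> snd (box_seq M p \<xi> n) i" for n i
    by (induction n arbitrary: i) (simp_all add: assms child_def half_box_bounds)
  show "fst (box_seq M p \<xi> n) i \<le> snd (box_seq M p \<xi> n) i" by (rule le)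
  have "fst (box_seq M p \<xi> n) i \<le> fst (box_seq M p \<xi> (Suc n)) i"
    "snd (box_seq M p \<xi> (Suc n)) i \<le> snd (box_seq M p \<xi> n) i" for n
    using half_box_bounds[OF le] by (simp_all add: child_def)
  then show "m \<le> n \<Longrightarrow> fst (box_seq M p \<xi> m) i \<le> fst (box_seq M p \<xi> n) i"
    "m \<le> n \<Longrightarrow> snd (box_seq M p \<xi> n) i \<le> snd (box_seq M p \<xi> m) i"
    using lift_Suc_mono_le[of "\<lambda>n. fst (box_seq M p \<xi> n) i"]
      lift_Suc_antimono_le[of "\<lambda>n. snd (box_seq M p \<xi> n) i"] by blast+
qed

text \<open>\<open>child\<close> can return a null half only if the other half is null too, and then
  the box itself would be null.\<close>

lemma emeasure_box_seq_pos:
  assumes M: "sets M = sets borel" and pos: "emeasure M (box_set p) \<noteq> 0"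
  shows "emeasure M (box_set (box_seq M p \<xi> n)) \<noteq> 0"
proof (induction n)
  case (Suc n)
  let ?p = "box_seq M p \<xi> n"
  have ms: "box_set q \<in> sets M" for q by (simp add: M)
  show ?case
  proof
    assume "emeasure M (box_set (box_seq M p \<xi> (Suc n))) = 0"
    then have "emeasure M (box_set (half_box n ?p (\<xi> n))) = 0"
      "emeasure M (box_set (half_box n ?p (\<not> \<xi> n))) = 0"
      unfolding box_seq.simps child_def by presburger+
    then have "emeasure M (box_set (half_box n ?p b)) = 0" for b
      by (cases "b = \<xi> n") simp_all
    moreover have "box_set ?p \<subseteq> box_set (half_box n ?p True) \<union> box_set (half_box n ?p False)"
    proof
      fix y assume "y \<in> box_set ?p"
      then obtain b where "y \<in> box_set (half_box n ?p b)" by (rule half_box_Un)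
      then show "y \<in> box_set (half_box n ?p True) \<union> box_set (half_box n ?p False)" by (cases b) auto
    qed
    ultimately have "emeasure M (box_set ?p) \<le> 0"
      using emeasure_mono[of "box_set ?p" "box_set (half_box n ?p True) \<union> box_set (half_box n ?p False)" M]
        emeasure_subadditive[OF ms[of "half_box n ?p True"] ms[of "half_box n ?p False"]] ms
      by simp
    with Suc show False by simp
  qed
qed (simp add: pos)

text \<open>The null halves met anywhere in the tree, countably many; a point outside them can be
  followed down from box to box.\<close>

definition null_boxes :: "(nat \<Rightarrow> real) measure \<Rightarrow> (nat \<Rightarrow> real) \<times> (nat \<Rightarrow> real) \<Rightarrow> (nat \<Rightarrow> real) set" where
  "null_boxes M p = \<Union>{box_set (half_box n (box_seq M p \<xi> n) b) | n \<xi> b.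
     emeasure M (box_set (half_box n (box_seq M p \<xi> n) b)) = 0}"

lemma null_boxes_null:
  assumes M: "sets M = sets borel"
  shows "null_boxes M p \<in> null_sets M"
proof -
  let ?F = "{box_set (half_box n (box_seq M p \<xi> n) b) | n \<xi> b.
     emeasure M (box_set (half_box n (box_seq M p \<xi> n) b)) = 0}"
  have "?F \<subseteq> (\<Union>n. (\<lambda>(q, b). box_set (half_box n q b)) ` (range (\<lambda>\<xi>. box_seq M p \<xi> n) \<times> UNIV))"
    by auto
  moreover have "countable (\<Union>n. (\<lambda>(q, b). box_set (half_box n q b)) ` (range (\<lambda>\<xi>. box_seq M p \<xi> n) \<times> UNIV))"
    by (intro countable_UN countableI_type countable_image countable_finite[OF finite_cartesian_product]
        finite_range_box_seq finite)
  ultimately have "countable ?F" by (rule countable_subset)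
  moreover have "N \<in> null_sets M" if "N \<in> ?F" for N
    using that by (auto simp: null_sets_def M)
  ultimately have "(\<Union>N\<in>?F. N) \<in> null_sets M" by (rule null_sets_UN')
  then show ?thesis by (simp add: null_boxes_def)
qed

text \<open>Any half on the way that contains \<open>y\<close> is not null, since \<open>y\<close>
  avoids the null boxes, so it occurs among the children.\<close>

lemma box_branch:
  assumes y: "y \<in> box_set (box_seq M p \<xi> n)" "y \<notin> null_boxes M p"
    and p: "\<And>i. fst p i \<le> snd p i"
  obtains \<eta> where "\<And>k. k < n \<Longrightarrow> \<eta> k = \<xi> k" "\<And>k. y \<in> box_set (box_seq M p \<eta> k)"
proof -
  define bit where "bit k q = (if k < n then \<xi> k else y \<in> box_set (child M k q True))" for k q
  \<comment> \<open>Boxes and bits are built together, because each bit from \<open>n\<close> on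
    depends on the box reached so far.\<close>
  define st where "st = rec_nat p (\<lambda>k q. child M k q (bit k q))"
  have st: "st 0 = p" "st (Suc k) = child M k (st k) (bit k (st k))" for k
    by (simp_all add: st_def)
  define \<eta> where "\<eta> k = bit k (st k)" for k
  have eq: "box_seq M p \<eta> k = st k" for k
    by (induction k) (simp_all add: st \<eta>_def)
  have \<eta>: "\<eta> k = \<xi> k" if "k < n" for k using that by (simp add: \<eta>_def bit_def)
  have "y \<in> box_set (box_seq M p \<eta> k)" if "k \<le> n" for k
  proof -
    have "y \<in> box_set (box_seq M p \<eta> n)" using box_seq_cong[of n \<eta> \<xi>] \<eta> y(1) by simp
    then show ?thesis
      using box_seq_mono(2,3)[of p k n M \<eta>, OF p that] unfolding box_set_def
      by (auto intro: order_trans)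
  qed
  moreover have "y \<in> box_set (box_seq M p \<eta> (n + k))" for k
  proof (induction k)
    case 0
    show ?case using calculation[of n] by simp
  next
    case (Suc k)
    let ?q = "box_seq M p \<eta> (n + k)"
    obtain b where b: "y \<in> box_set (half_box (n + k) ?q b)" using Suc half_box_Un by blast
    then have "emeasure M (box_set (half_box (n + k) ?q b)) \<noteq> 0"
      using y(2) unfolding null_boxes_def by auto
    with b have "y \<in> box_set (child M (n + k) ?q b)" by (simp add: child_def)
    then have "y \<in> box_set (child M (n + k) ?q (bit (n + k) ?q))"
      by (cases "y \<in> box_set (child M (n + k) ?q True)"; cases b) (simp_all add: bit_def)
    then show ?case unfolding add_Suc_right eq st .
  qed
  ultimately have "y \<in> box_set (box_seq M p \<eta> k)" for k
    by (metis le_add_diff_inverse nat_le_linear)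
  with \<eta> show ?thesis by (rule that)
qed

text \<open>If the corners of \<open>p\<close> are ordered, this is the one point common to all
  boxes along the branch.\<close>

definition box_point :: "(nat \<Rightarrow> real) measure \<Rightarrow> (nat \<Rightarrow> real) \<times> (nat \<Rightarrow> real) \<Rightarrow> cantor \<Rightarrow> nat \<Rightarrow> real" where
  "box_point M p \<xi> i = (SUP n. fst (box_seq M p \<xi> n) i)"

lemma box_point_mem:
  assumes p: "\<And>i. fst p i \<le> snd p i"
  shows "box_point M p \<xi> \<in> box_set (box_seq M p \<xi> n)"
proof -
  have le: "fst (box_seq M p \<xi> m) i \<le> snd (box_seq M p \<xi> n) i" for m n i
    using box_seq_mono[of p, OF p, where \<xi> = \<xi> and M = M] 
    by (metis nat_le_linear order_trans)
  then have "bdd_above (range (\<lambda>n. fst (box_seq M p \<xi> n) i))" for i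
    by (meson bdd_above.I2)
  with le show ?thesis unfolding box_set_def box_point_def
    by (auto intro!: cSUP_upper cSUP_least)
qed

lemma box_point_eqI:
  assumes p: "\<And>i. fst p i \<le> snd p i"
    and y: "\<And>n. y \<in> box_set (box_seq M p \<xi> n)"
  shows "y = box_point M p \<xi>"
proof
  fix i
  have "\<bar>y i - box_point M p \<xi> i\<bar> \<le> width p n i" for n
    using y[of n] box_point_mem[OF p, where M = M and \<xi> = \<xi> and n = n] box_seq_width[of M p \<xi> n i]
    unfolding box_set_def by (simp add: abs_le_iff) (smt (verit))
  from LIMSEQ_le_const[OF width_tendsto_0[OF p], of "\<bar>y i - box_point M p \<xi> i\<bar>"] this
  show "y i = box_point M p \<xi> i" by auto
qed

text \<open>Branches that agree below \<open>n\<close> share the box at depth \<open>n\<close>,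
  whose side \<open>width p n i\<close> bounds the change of coordinate \<open>i\<close>.\<close>

lemma continuous_box_point:
  assumes p: "\<And>i. fst p i \<le> snd p i"
  shows "continuous_on UNIV (box_point M p)"
  unfolding continuous_on_fun_iff
proof
  fix i
  show "continuous_on UNIV (\<lambda>\<xi>. box_point M p \<xi> i)"
    unfolding continuous_on_def
  proof (intro ballI tendstoI)
    fix \<xi> :: cantor and e :: real assume "e > 0"
    then obtain n where n: "width p n i < e"
      using order_tendstoD(2)[OF width_tendsto_0[OF p], of e i] by (auto simp: eventually_sequentially)
    define V where "V = (\<Inter>k\<in>{..<n}. (\<lambda>x::cantor. x k) -` {\<xi> k})"
    have "open V" unfolding V_def
      by (intro open_INT ballI open_vimage) (simp_all add: open_discrete)
    moreover have "\<xi> \<in> V" by (simp add: V_def)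
    moreover have "dist (box_point M p \<eta> i) (box_point M p \<xi> i) < e" if "\<eta> \<in> V" for \<eta>
    proof -
      have "box_seq M p \<eta> n = box_seq M p \<xi> n" using that by (intro box_seq_cong) (simp add: V_def)
      then have "\<bar>box_point M p \<eta> i - box_point M p \<xi> i\<bar> \<le> width p n i"
        using box_point_mem[OF p, where M = M and \<xi> = \<xi> and n = n] 
          box_point_mem[OF p, where M = M and \<xi> = \<eta> and n = n] box_seq_width[of M p \<xi> n i]
        unfolding box_set_def by (simp add: abs_le_iff) (smt (verit))
      with n show ?thesis by (simp add: dist_real_def)
    qed
    ultimately show "\<forall>\<^sub>F \<eta> in at \<xi> within UNIV. dist (box_point M p \<eta> i) (box_point M p \<xi> i) < e"
      unfolding eventually_at_topological by blast
  qed
qed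

text \<open>Tightness: cutting off the tails of coordinate \<open>i\<close> at a loss below
  \<open>(1/2) ^ (i + 2)\<close> leaves a box of measure at least \<open>1/2\<close>.\<close>

lemma exists_box_pos:
  fixes M :: "(nat \<Rightarrow> real) measure"
  assumes M: "sets M = sets borel" and prob: "prob_space M"
  obtains p where "\<And>i. fst p i \<le> snd p i" "emeasure M (box_set p) \<noteq> 0"
proof -
  interpret prob_space M by fact
  have [measurable]: "(\<lambda>y. y i) \<in> borel_measurable M" for i
    by (simp add: measurable_cong_sets[OF M refl] borel_measurable_continuous_onI)
  have sp: "space M = UNIV" using sets_eq_imp_space_eq[OF M] by simp
  have "\<exists>k. measure M {y. \<bar>y i\<bar> > real k} < (1/2) ^ Suc i * (1/2)" for i
  proof -
    have "(\<lambda>k. measure M {y. \<bar>y i\<bar> > real k}) \<longlonglongrightarrow> measure M (\<Inter>k. {y. \<bar>y i\<bar> > real k})"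
    proof (rule finite_Lim_measure_decseq)
      have "{y \<in> space M. \<bar>y i\<bar> > real k} \<in> sets M" for k by measurable
      then show "range (\<lambda>k. {y. \<bar>y i\<bar> > real k}) \<subseteq> sets M" by (auto simp: sp)
    qed (auto simp: decseq_def)
    moreover have "\<exists>k. \<not> \<bar>y i\<bar> > real k" for y :: "nat \<Rightarrow> real"
      using reals_Archimedean2[of "\<bar>y i\<bar>"] by (auto intro: less_imp_le simp: not_less)
    then have "(\<Inter>k. {y::nat \<Rightarrow> real. \<bar>y i\<bar> > real k}) = {}" by blast
    ultimately have "(\<lambda>k. measure M {y. \<bar>y i\<bar> > real k}) \<longlonglongrightarrow> 0"
      by (simp only: measure_empty)
    from order_tendstoD(2)[OF this, of "(1/2) ^ Suc i * (1/2)"] show ?thesis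
      by (auto simp: eventually_sequentially)
  qed
  then obtain k where k: "\<And>i. measure M {y. \<bar>y i\<bar> > real (k i)} < (1/2) ^ Suc i * (1/2)" by metis
  define A where "A i = {y::nat \<Rightarrow> real. \<bar>y i\<bar> > real (k i)}" for i
  have "{y \<in> space M. \<bar>y i\<bar> > real (k i)} \<in> sets M" for i by measurable
  then have A: "A i \<in> sets M" for i by (simp add: A_def sp)
  have S: "(\<lambda>i. (1/2) ^ Suc i * (1/2 :: real)) sums (1 * (1/2))"
    by (intro sums_mult2 power_half_series)
  have sm: "summable (\<lambda>i. measure M (A i))"
    by (rule summable_comparison_test'[OF sums_summable[OF S], of 0])
       (use k in \<open>auto simp: A_def intro: less_imp_le\<close>)
  have "measure M (\<Union>i. A i) \<le> (\<Sum>i. measure M (A i))"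
    by (rule finite_measure_subadditive_countably) (use A sm in auto)
  also have "\<dots> \<le> 1/2"
    using suminf_le[OF _ sm sums_summable[OF S]] k sums_unique[OF S]
    by (simp add: A_def less_imp_le)
  finally have "measure M (\<Union>i. A i) \<le> 1/2" .
  moreover have "measure M (UNIV - (\<Union>i. A i)) = 1 - measure M (\<Union>i. A i)"
    using prob_compl[of "\<Union>i. A i"] A by (simp add: sp)
  moreover define p where "p = ((\<lambda>i. - real (k i)), (\<lambda>i. real (k i)))"
  moreover have "UNIV - (\<Union>i. A i) = box_set p"
    by (auto simp: A_def box_set_def p_def abs_le_iff not_less) (smt (verit))+
  ultimately have "measure M (box_set p) > 0" by simp
  then have "emeasure M (box_set p) \<noteq> 0" by (simp add: measure_def) (metis enn2real_0 less_irrefl)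
  then show ?thesis by (rule that[rotated]) (simp add: p_def)
qed

text \<open>If the closed preimage of a translate had interior, it would contain a cylinder. Up to a
  null set, the box belonging to that cylinder would then be covered by the null translate, but no
  box in the tree is null.\<close>

lemma closed_haar_null_imp_haar_meager:
  fixes A :: "(nat \<Rightarrow> real) set"
  assumes "closed A" "haar_null A"
  shows "haar_meager A"
proof -
  from assms(2) obtain M where A: "A \<in> sets borel" and M: "sets M = sets borel" "prob_space M"
    and null: "\<And>x. emeasure M (translate A x) = 0"
    unfolding haar_null_def by blast
  obtain p where p: "\<And>i. fst p i \<le> snd p i" and pos: "emeasure M (box_set p) \<noteq> 0"
    by (rule exists_box_pos[OF M]) blast
  let ?f = "box_point M p"
  have "meager (?f -` translate A x)" for x
  proof (rule nowhere_dense_imp_meager)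
    have "closed (translate A x)"
      unfolding translate_eq_vimage by (intro closed_vimage assms continuous_intros)
    then have cl: "closed (?f -` translate A x)"
      by (intro closed_vimage continuous_box_point p)
    have "interior (?f -` translate A x) = {}"
    proof (rule ccontr)
      assume "interior (?f -` translate A x) \<noteq> {}"
      then obtain \<xi> where "\<xi> \<in> interior (?f -` translate A x)" by blast
      from open_nat_fun_contains_box[OF open_interior this] obtain X n
        where X: "\<And>i. \<xi> i \<in> X i"
          "\<And>\<eta>. (\<And>i. i < n \<Longrightarrow> \<eta> i \<in> X i) \<Longrightarrow> \<eta> \<in> interior (?f -` translate A x)" by metis
      have "box_set (box_seq M p \<xi> n) \<subseteq> translate A x \<union> null_boxes M p"
      proof
        fix y assume y: "y \<in> box_set (box_seq M p \<xi> n)"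
        show "y \<in> translate A x \<union> null_boxes M p"
        proof (cases "y \<in> null_boxes M p")
          case False
          from box_branch[OF y False p] obtain \<eta>
            where \<eta>: "\<And>k. k < n \<Longrightarrow> \<eta> k = \<xi> k" "\<And>k. y \<in> box_set (box_seq M p \<eta> k)"
            by metis
          have "\<eta> \<in> interior (?f -` translate A x)" using X \<eta>(1) by simp
          moreover have "y = ?f \<eta>" by (rule box_point_eqI[OF p \<eta>(2)])
          ultimately show ?thesis using interior_subset[of "?f -` translate A x"] by auto
        qed simp
      qed
      moreover have "translate A x \<union> null_boxes M p \<in> null_sets M"
        using null null_boxes_null[OF M(1)] translate_borel[OF A]
        by (intro null_sets.Un) (simp_all add: null_sets_def M)
      ultimately have "box_set (box_seq M p \<xi> n) \<in> null_sets M"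
        using null_sets_subset[of _ M "box_set (box_seq M p \<xi> n)"] by (simp add: M)
      then show False using emeasure_box_seq_pos[OF M(1) pos] by (simp add: null_sets_def)
    qed
    with cl show "nowhere_dense (?f -` translate A x)" by (simp add: nowhere_dense_def)
  qed
  then show ?thesis
    unfolding haar_meager_def by (intro conjI A exI[of _ ?f] allI continuous_box_point p)
qed

lemma sigma_closed_HN_subset_HM: "sigma_closed_HN \<subseteq> (sigma_closed_HM :: (nat \<Rightarrow> real) set set)"
  unfolding sigma_closed_HN_def sigma_closed_HM_def
  by (intro Collect_mono impI, elim exE conjE, intro exI conjI)
     (simp_all add: closed_haar_null_imp_haar_meager)

section \<open>Coded sequences\<close>

text \<open>\<open>hist b n\<close> numbers the initial segment of \<open>b\<close> of length \<open>n\<close>.\<close>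

primrec hist :: "(nat \<Rightarrow> nat) \<Rightarrow> nat \<Rightarrow> nat" where
  "hist b 0 = 0"
| "hist b (Suc n) = Suc (prod_encode (b n, hist b n))"

lemma hist_inj:
  assumes "hist b m = hist c n"
  shows "m = n" "i < m \<Longrightarrow> b i = c i"
proof -
  have "m = n \<and> (\<forall>i<m. b i = c i)" using assms
  proof (induction m arbitrary: n)
    case 0
    then show ?case by (cases n) auto
  next
    case (Suc m)
    then obtain n' where "n = Suc n'" by (cases n) auto
    with Suc show ?case by (auto simp: less_Suc_eq)
  qed
  then show "m = n" "i < m \<Longrightarrow> b i = c i" by auto
qed

lemma hist_cong: "(\<And>i. i < n \<Longrightarrow> b i = c i) \<Longrightarrow> hist b n = hist c n"
  by (induction n) auto

text \<open>The first bound lets a large digit force a long cell; the second makes the cells move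
  out with the coordinate.\<close>

lemma hist_Suc_gt: "b n < hist b (Suc n)" "hist b n < hist b (Suc n)"
  using le_prod_encode_1[of "b n" "hist b n"] le_prod_encode_2[of "hist b n" "b n"]
  by (simp_all add: less_Suc_eq_le)

lemma hist_ge: "n \<le> hist b n"
proof (induction n)
  case (Suc n)
  then show ?case using hist_Suc_gt(2)[of b n] by linarith
qed simp

section \<open>Rapidly growing cells\<close>

definition base :: "nat \<Rightarrow> real" where
  "base k = (fact k)\<^sup>2"

text \<open>The length \<open>k + 1\<close> is unbounded, which leaves room for compact sets, but it
  is negligible against \<open>base k\<close>.\<close>

definition cell :: "nat \<Rightarrow> real set" where
  "cell k = {base k <..< base k + real k + 1}"

lemma base_Suc: "base (Suc k) = (real (Suc k))\<^sup>2 * base k"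
  by (simp add: base_def power_mult_distrib)

lemma base_ge_1: "1 \<le> base k"
  by (simp add: base_def fact_ge_1)

lemma base_mono: "j \<le> k \<Longrightarrow> base j \<le> base k"
  by (simp add: base_def fact_mono power_mono)

lemma base_Suc_ge:
  assumes "1 \<le> k"
  shows "base k + real k + 1 \<le> base (Suc k)"
proof -
  have "real k + 1 \<le> (real k + 1) * base k" using base_ge_1[of k] by simp
  also have "\<dots> + base k \<le> (real (Suc k))\<^sup>2 * base k"
  proof -
    have "1 \<le> real k" "0 \<le> real k * real k" using assms by simp_all
    moreover have "(real (Suc k))\<^sup>2 = real k * real k + 2 * real k + 1"
      by (simp add: power2_eq_square algebra_simps)
    ultimately have "(real k + 1) + 1 \<le> (real (Suc k))\<^sup>2" by linarith
    from mult_right_mono[OF this, of "base k"] show ?thesis using base_ge_1[of k] by (simp add: algebra_simps)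
  qed
  finally show ?thesis by (simp add: base_Suc algebra_simps)
qed

text \<open>One bound for two errors relative to \<open>base (Suc j)\<close>: the size of numbers in
  cells up to \<open>j\<close>, and the offset within cell \<open>Suc j\<close>.\<close>

lemma base_ratio: "(base j + real (Suc j) + 1) / base (Suc j) \<le> 3 / real (Suc j)"
proof -
  have "base j + real (Suc j) + 1 \<le> 3 * real (Suc j) * base j"
  proof -
    have "base j \<le> real (Suc j) * base j" "real (Suc j) + 1 \<le> 2 * (real (Suc j) * 1)"
      using base_ge_1[of j] by simp_all
    moreover have "real (Suc j) * 1 \<le> real (Suc j) * base j"
      using base_ge_1[of j] by (intro mult_left_mono) simp_all
    ultimately show ?thesis by linarith
  qed
  then show ?thesis using base_ge_1[of j]
    by (simp add: base_Suc divide_le_eq power2_eq_square del: of_nat_Suc)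
qed

text \<open>For positive indices \<open>base_Suc_ge\<close> separates consecutive cells; index 0 is
  excluded because \<open>base 0 = base 1\<close>.\<close>

lemma cell_unique:
  assumes "t \<in> cell k" "t \<in> cell l" "1 \<le> k" "1 \<le> l"
  shows "k = l"
proof -
  have False if "t \<in> cell k" "t \<in> cell l" "1 \<le> k" "k < l" for k l
    using that base_Suc_ge[of k] base_mono[of "Suc k" l] by (simp add: cell_def)
  from this[of k l] this[of l k] assms show ?thesis by (meson nat_neq_iff)
qed

section \<open>Codes and coded sequences\<close>

definition approx :: "nat \<Rightarrow> nat \<Rightarrow> real" where
  "approx c i = real_of_rat ((from_nat c :: rat list) ! i)"

lemma approx_dense:
  assumes "0 < e"
  obtains c where "\<And>i. i < n \<Longrightarrow> \<bar>x i - approx c i\<bar> < e"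
proof -
  have "\<exists>q. \<bar>x i - real_of_rat q\<bar> < e" for i
  proof -
    obtain q where "x i - e < real_of_rat q" "real_of_rat q < x i"
      using of_rat_dense[of "x i - e" "x i"] assms by auto
    then show ?thesis by (intro exI[of _ q]) (simp add: abs_less_iff)
  qed
  then obtain q where q: "\<And>i. \<bar>x i - real_of_rat (q i)\<bar> < e" by metis
  show ?thesis
    by (rule that[of "to_nat (map q [0..<n])"]) (simp add: approx_def q)
qed

text \<open>An odd digit carries a rational approximation of all earlier coordinates. An even digit carries
  nothing, but its size makes the cell long, which is what lets a translate of a compact set fit in.\<close>

definition coded_at :: "(nat \<Rightarrow> nat) \<Rightarrow> (nat \<Rightarrow> real) \<Rightarrow> nat \<Rightarrow> bool" where
  "coded_at b x m \<longleftrightarrow> x m \<in> cell (hist b (Suc m)) \<and>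
     (odd (b m) \<longrightarrow> (\<forall>i<m. \<bar>x i - approx (b m div 2) i\<bar> < 1 / real (Suc m)))"

text \<open>Infinitely many odd digits provide approximations of every coordinate to any accuracy,
  so that \<open>b\<close> determines \<open>x\<close>.\<close>

definition codes :: "(nat \<Rightarrow> nat) \<Rightarrow> (nat \<Rightarrow> real) \<Rightarrow> bool" where
  "codes b x \<longleftrightarrow> (\<forall>m. coded_at b x m) \<and> (\<exists>\<^sub>\<infinity>m. odd (b m))"

definition coded_set :: "(nat \<Rightarrow> real) set" where
  "coded_set = {x. \<exists>b. codes b x}"

lemma coded_at_cong: "(\<And>i. i \<le> m \<Longrightarrow> b i = c i) \<Longrightarrow> coded_at b x m \<longleftrightarrow> coded_at c x m"
  using hist_cong[of "Suc m" b c] by (simp add: coded_at_def)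

text \<open>The cell containing \<open>x m\<close> reveals the number of the initial segment, hence
  all digits up to \<open>m\<close>.\<close>

lemma coded_at_unique:
  assumes "coded_at b x m" "coded_at c x m" "i \<le> m"
  shows "b i = c i"
proof -
  have "hist b (Suc m) = hist c (Suc m)"
    using assms hist_ge[of "Suc m" b] hist_ge[of "Suc m" c]
    by (intro cell_unique[of "x m"]) (auto simp: coded_at_def simp del: hist.simps)
  from hist_inj(2)[OF this] show ?thesis using assms(3) by simp
qed

lemma open_Collect_all_less:
  fixes n :: nat
  assumes "\<And>i. i < n \<Longrightarrow> open {x. P i x}"
  shows "open {x. \<forall>i<n. P i x}"
proof -
  have "open (\<Inter>i\<in>{..<n}. {x. P i x})" using assms by (intro open_INT) auto
  also have "(\<Inter>i\<in>{..<n}. {x. P i x}) = {x. \<forall>i<n. P i x}" by auto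
  finally show ?thesis .
qed

lemma open_coded_at: "open {x. coded_at b x m}"
proof -
  have c: "continuous_on UNIV (\<lambda>x::nat \<Rightarrow> real. x i)" for i by simp
  have "open {x::nat \<Rightarrow> real. \<bar>x i - a\<bar> < e}" for a e :: real and i
    by (intro open_Collect_less continuous_intros c)
  then have 1: "open {x::nat \<Rightarrow> real. \<forall>i<m. \<bar>x i - approx (b m div 2) i\<bar> < 1 / real (Suc m)}"
    by (intro open_Collect_all_less)
  have 2: "open {x::nat \<Rightarrow> real. a < x m}" "open {x::nat \<Rightarrow> real. x m < a}" for a
    by (intro open_Collect_less continuous_intros c)+
  show ?thesis
    unfolding coded_at_def cell_def greaterThanLessThan_iff
    by (intro open_Collect_conj open_Collect_imp 1 2) simp
qed

text \<open>A G-delta description: codes valid on longer and longer initial segments agree where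
  they overlap, by \<open>coded_at_unique\<close>, and combine into one code.\<close>

lemma coded_set_eq:
  "coded_set = (\<Inter>p. \<Union>(b, M) \<in> {(b, M). \<exists>j. p \<le> j \<and> j < M \<and> odd (b j)}. {x. \<forall>m<M. coded_at b x m})"
proof (intro set_eqI iffI)
  fix x assume "x \<in> coded_set"
  then obtain b where b: "codes b x" unfolding coded_set_def by blast
  show "x \<in> (\<Inter>p. \<Union>(b, M) \<in> {(b, M). \<exists>j. p \<le> j \<and> j < M \<and> odd (b j)}. {x. \<forall>m<M. coded_at b x m})"
  proof
    fix p
    obtain j where "p \<le> j" "odd (b j)" using b unfolding codes_def INFM_nat_le by blast
    then show "x \<in> (\<Union>(b, M) \<in> {(b, M). \<exists>j. p \<le> j \<and> j < M \<and> odd (b j)}. {x. \<forall>m<M. coded_at b x m})"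
      using b by (intro UN_I[of "(b, Suc j)"]) (auto simp: codes_def)
  qed
next
  fix x assume "x \<in> (\<Inter>p. \<Union>(b, M) \<in> {(b, M). \<exists>j. p \<le> j \<and> j < M \<and> odd (b j)}. {x. \<forall>m<M. coded_at b x m})"
  then have "\<forall>p. \<exists>b M. (\<exists>j. p \<le> j \<and> j < M \<and> odd (b j)) \<and> (\<forall>m<M. coded_at b x m)" by blast
  then obtain B M where J: "\<And>p. \<exists>j. p \<le> j \<and> j < M p \<and> odd (B p j)"
    and c: "\<And>p m. m < M p \<Longrightarrow> coded_at (B p) x m" by metis
  have M: "p < M p" for p using J[of p] by auto
  \<comment> \<open>The diagonal works because \<open>i < M i\<close>, so that \<open>B i\<close> is
    valid at digit \<open>i\<close>.\<close>
  define b where "b i = B i i" for i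
  have b: "b i = B p i" if "i < M p" for i p
    using coded_at_unique[OF c[OF M[of i]] c[OF that]] by (simp add: b_def)
  have "coded_at b x m" for m
    using coded_at_cong[of m b "B m" x] b[of _ m] M[of m] c[of m m] by simp
  moreover have "\<exists>\<^sub>\<infinity>m. odd (b m)"
    unfolding INFM_nat_le using J b by metis
  ultimately show "x \<in> coded_set" unfolding coded_set_def codes_def by blast
qed

lemma coded_set_borel [measurable]: "coded_set \<in> sets borel"
proof -
  have "open {x. \<forall>m<M. coded_at b x m}" for b M
    by (intro open_Collect_all_less open_coded_at)
  then have "open (\<Union>(b, M) \<in> {(b, M). \<exists>j. p \<le> j \<and> j < M \<and> odd (b j)}. {x. \<forall>m<M. coded_at b x m})" for p
    by (auto intro!: open_UN)
  then show ?thesis unfolding coded_set_eq by (intro sets.countable_INT borel_open) auto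
qed

text \<open>Sample and hold: an index enters only from the next position on, and the initial 0 does
  not affect limits.\<close>

primrec hold :: "(nat \<Rightarrow> bool) \<Rightarrow> (nat \<Rightarrow> real) \<Rightarrow> nat \<Rightarrow> real" where
  "hold P a 0 = 0"
| "hold P a (Suc m) = (if P m then a m else hold P a m)"

lemma hold_tendsto:
  assumes inf: "\<exists>\<^sub>\<infinity>m. P m"
    and lim: "\<And>e. 0 < e \<Longrightarrow> \<forall>\<^sub>F m in sequentially. P m \<longrightarrow> \<bar>a m - l\<bar> < e"
  shows "hold P a \<longlonglongrightarrow> l"
proof (rule LIMSEQ_I)
  fix e :: real assume "0 < e"
  from lim[OF this] obtain N where N: "\<And>m. N \<le> m \<Longrightarrow> P m \<Longrightarrow> \<bar>a m - l\<bar> < e"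
    unfolding eventually_sequentially by blast
  from inf obtain p where p: "N \<le> p" "P p" unfolding INFM_nat_le by blast
  have "\<bar>hold P a n - l\<bar> < e" if "Suc p \<le> n" for n
    using that
  proof (induction n rule: dec_induct)
    case base
    show ?case using p N by simp
  next
    case (step n)
    then show ?case using p N by simp
  qed
  then show "\<exists>no. \<forall>n\<ge>no. norm (hold P a n - l) < e" unfolding real_norm_def by blast
qed

lemma hold_cong:
  "(\<And>m. m < n \<Longrightarrow> P m = Q m) \<Longrightarrow> (\<And>m. m < n \<Longrightarrow> a m = c m) \<Longrightarrow> hold P a n = hold Q c n"
  by (induction n) auto

section \<open>Recovering a point from its code\<close>

definition point_approx :: "(nat \<Rightarrow> nat) \<Rightarrow> nat \<Rightarrow> nat \<Rightarrow> real" where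
  "point_approx b m i = hold (\<lambda>j. odd (b j)) (\<lambda>j. approx (b j div 2) i) m"

lemma point_approx_cong: "(\<And>j. j < m \<Longrightarrow> b j = c j) \<Longrightarrow> point_approx b m i = point_approx c m i"
  unfolding point_approx_def by (rule hold_cong) auto

text \<open>An odd digit at \<open>m > i\<close> approximates coordinate \<open>i\<close> to within
  \<open>1 / (m + 1)\<close>.\<close>

lemma point_approx_tendsto:
  assumes "codes b x"
  shows "(\<lambda>m. point_approx b m i) \<longlonglongrightarrow> x i"
proof -
  have "hold (\<lambda>j. odd (b j)) (\<lambda>j. approx (b j div 2) i) \<longlonglongrightarrow> x i"
  proof (rule hold_tendsto)
    show "\<exists>\<^sub>\<infinity>m. odd (b m)" using assms by (simp add: codes_def)
    fix e :: real assume "0 < e"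
    have "(\<lambda>m. 1 / real (Suc m)) \<longlonglongrightarrow> 0" by (rule LIMSEQ_Suc[OF lim_1_over_n])
    from order_tendstoD(2)[OF this \<open>0 < e\<close>] eventually_gt_at_top[of i]
    show "\<forall>\<^sub>F m in sequentially. odd (b m) \<longrightarrow> \<bar>approx (b m div 2) i - x i\<bar> < e"
    proof eventually_elim
      case (elim m)
      have "coded_at b x m" using assms by (simp add: codes_def)
      with elim show ?case unfolding coded_at_def by (auto simp: abs_minus_commute intro: less_trans)
    qed
  qed
  then show ?thesis by (simp add: point_approx_def[abs_def])
qed

text \<open>\<open>point_approx\<close> depends on the code alone, and both points are its
  limit.\<close>

lemma codes_inject:
  assumes "codes b x" "codes b y"
  shows "x = y"
  using LIMSEQ_unique[OF point_approx_tendsto[OF assms(1)] point_approx_tendsto[OF assms(2)]] by blast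

lemma codes_bounds:
  assumes "codes b x"
  shows "base (hist b (Suc m)) < x m" "x m < base (hist b (Suc m)) + real (hist b (Suc m)) + 1"
  using assms by (simp_all add: codes_def coded_at_def cell_def del: hist.simps)

section \<open>The span of the coded sequences\<close>

text \<open>The thresholds are the geometric means of consecutive values of \<open>base\<close>, so that a constant
  factor does not change the result for large arguments.\<close>

definition scale_index :: "real \<Rightarrow> nat" where
  "scale_index t = (LEAST k. \<bar>t\<bar> \<le> fact k * fact (Suc k))"

text \<open>The thresholds around \<open>base k\<close> are \<open>base k / k\<close> and
  \<open>(k + 1) * base k\<close>, so the window relative to \<open>base k\<close> widens as
  \<open>k\<close> grows.\<close>

lemma scale_index_eqI:
  assumes "1 \<le> k" "1 / real k < \<bar>t / base k\<bar>" "\<bar>t / base k\<bar> \<le> real k + 1"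
  shows "scale_index t = k"
proof -
  have b: "base k > 0" using base_ge_1[of k] by linarith
  show ?thesis unfolding scale_index_def
  proof (rule Least_equality)
    have "\<bar>t\<bar> = \<bar>t / base k\<bar> * base k" using b by (simp add: abs_divide)
    also have "\<dots> \<le> (real k + 1) * base k" using assms(3) b by (intro mult_right_mono) simp_all
    finally have "\<bar>t\<bar> \<le> (real k + 1) * base k" .
    then show "\<bar>t\<bar> \<le> fact k * fact (Suc k)"
      by (simp add: base_def power2_eq_square algebra_simps)
  next
    fix j assume j: "\<bar>t\<bar> \<le> fact j * fact (Suc j)"
    show "k \<le> j"
    proof (rule ccontr)
      assume "\<not> k \<le> j"
      then have "Suc j \<le> k" by simp
      then have le: "fact j \<le> (fact (k - 1) :: real)" "fact (Suc j) \<le> (fact k :: real)"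
        by (intro fact_mono; simp)+
      have "\<bar>t\<bar> \<le> fact (k - 1) * fact k" using j mult_mono[OF le] by simp
      also have "\<dots> = base k / real k"
        using assms(1) by (cases k) (simp_all add: base_def power2_eq_square)
      finally have "\<bar>t / base k\<bar> \<le> 1 / real k"
        using b assms(1) by (simp add: field_simps)
      with assms(2) show False by simp
    qed
  qed
qed

definition code_of :: "(nat \<Rightarrow> real) \<Rightarrow> nat \<Rightarrow> nat" where
  "code_of x = (SOME b. codes b x)"

lemma codes_code_of: "x \<in> coded_set \<Longrightarrow> codes (code_of x) x"
  unfolding coded_set_def code_of_def mem_Collect_eq by (rule someI_ex[of "\<lambda>b. codes b x"])

text \<open>Distinct points have codes that differ at some digit, and segments reaching past it have
  different numbers; finitely many pairs share a threshold.\<close>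

lemma eventually_hist_neq:
  assumes "finite S" "S \<subseteq> coded_set"
  obtains n0 where "\<And>n x y. n0 \<le> n \<Longrightarrow> x \<in> S \<Longrightarrow> y \<in> S \<Longrightarrow> x \<noteq> y \<Longrightarrow>
    hist (code_of x) n \<noteq> hist (code_of y) n"
proof -
  have "\<forall>\<^sub>F n in sequentially. x \<noteq> y \<longrightarrow> hist (code_of x) n \<noteq> hist (code_of y) n"
    if "x \<in> S" "y \<in> S" for x y
  proof (cases "x = y")
    case False
    then have "code_of x \<noteq> code_of y" using codes_inject codes_code_of assms(2) that by (metis subsetD)
    then obtain i where "code_of x i \<noteq> code_of y i" by auto
    then have "hist (code_of x) n \<noteq> hist (code_of y) n" if "i < n" for n
      using hist_inj(2)[of "code_of x" n "code_of y" n i] that by metis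
    then show ?thesis unfolding eventually_sequentially by (intro exI[of _ "Suc i"]) simp
  qed simp
  then have "\<forall>\<^sub>F n in sequentially. \<forall>x\<in>S. \<forall>y\<in>S. x \<noteq> y \<longrightarrow> hist (code_of x) n \<noteq> hist (code_of y) n"
    by (intro eventually_ball_finite assms(1) ballI)
  then show ?thesis unfolding eventually_sequentially using that by meson
qed

text \<open>For finite subsets of \<open>coded_set\<close>, ties in the maximum occur at only
  finitely many \<open>m\<close>, by \<open>eventually_hist_neq\<close>.\<close>

definition dominant :: "(nat \<Rightarrow> real) set \<Rightarrow> nat \<Rightarrow> nat \<Rightarrow> real" where
  "dominant S m = (ARG_MAX (\<lambda>x. hist (code_of x) (Suc m)) x. x \<in> S)"

definition top_scale :: "(nat \<Rightarrow> real) set \<Rightarrow> nat \<Rightarrow> nat" where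
  "top_scale S m = hist (code_of (dominant S m)) (Suc m)"

lemma dominant:
  assumes "finite S" "S \<noteq> {}"
  shows "dominant S m \<in> S" "x \<in> S \<Longrightarrow> hist (code_of x) (Suc m) \<le> top_scale S m"
proof -
  have "dominant S m \<in> S \<and> (\<forall>x\<in>S. hist (code_of x) (Suc m) \<le> hist (code_of (dominant S m)) (Suc m))"
  proof -
    let ?H = "(\<lambda>x. hist (code_of x) (Suc m)) ` S"
    have "Max ?H \<in> ?H" using assms by (intro Max_in) simp_all
    then obtain y where y: "y \<in> S" "hist (code_of y) (Suc m) = Max ?H"
      by (metis (mono_tags, lifting) imageE)
    have y_max: "hist (code_of x) (Suc m) \<le> hist (code_of y) (Suc m)" if "x \<in> S" for x
      unfolding y(2) using assms(1) that by (intro Max_ge) simp_all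
    show ?thesis unfolding dominant_def
      by (rule arg_maxI[of _ y]) (use y(1) y_max in \<open>auto simp: not_less simp del: hist.simps\<close>)
  qed
  then show "dominant S m \<in> S" "x \<in> S \<Longrightarrow> hist (code_of x) (Suc m) \<le> top_scale S m"
    by (auto simp: top_scale_def)
qed

lemma top_scale_gt: "m < top_scale S m"
  using hist_ge[of "Suc m" "code_of (dominant S m)"] by (simp add: top_scale_def del: hist.simps)

lemma sum_fun_apply: "(\<Sum>x\<in>S. f x) i = (\<Sum>x\<in>S. f x i)" for f :: "'a \<Rightarrow> 'b \<Rightarrow> 'c::comm_monoid_add"
  by (induction S rule: infinite_finite_induct) simp_all

text \<open>Division by \<open>base (top_scale S m)\<close> brings the dominant coordinate close to
  1 and all others close to 0, so only one coefficient survives.\<close>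

lemma dominant_asymptotics:
  assumes S: "finite S" "S \<noteq> {}" "S \<subseteq> coded_set"
  shows "(\<lambda>m. (\<Sum>x\<in>S. c x *\<^sub>R x) m / base (top_scale S m) - c (dominant S m)) \<longlonglongrightarrow> 0"
proof -
  obtain n0 where n0: "\<And>n x y. n0 \<le> n \<Longrightarrow> x \<in> S \<Longrightarrow> y \<in> S \<Longrightarrow> x \<noteq> y \<Longrightarrow>
    hist (code_of x) n \<noteq> hist (code_of y) n"
    using eventually_hist_neq[OF S(1,3)] by metis
  define C where "C = (\<Sum>x\<in>S. \<bar>c x\<bar>)"
  have "norm ((\<Sum>x\<in>S. c x *\<^sub>R x) m / base (top_scale S m) - c (dominant S m)) \<le> C * (3 / real (Suc m))"
    if m: "n0 \<le> m" for m
  proof -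
    let ?k = "top_scale S m" and ?d = "dominant S m"
    have d: "?d \<in> S" by (rule dominant[OF S(1,2)])
    obtain j where j: "?k = Suc j" using top_scale_gt[of m S] by (cases ?k) auto
    have mj: "m \<le> j" using top_scale_gt[of m S] j by simp
    have pos: "base ?k > 0" using base_ge_1[of ?k] by linarith
    \<comment> \<open>\<open>r\<close> serves both cases: the dominant summand lies in cell
      \<open>Suc j\<close>, the others in cells up to \<open>j\<close>.\<close>
    define r where "r = (base j + real (Suc j) + 1) / base (Suc j)"
    have err: "\<bar>x m / base ?k - (if x = ?d then 1 else 0)\<bar> \<le> r" if x: "x \<in> S" for x
    proof -
      have cx: "codes (code_of x) x" using codes_code_of S(3) x by blast
      let ?h = "hist (code_of x) (Suc m)"
      note bd = codes_bounds[OF cx, of m]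
      show ?thesis
      proof (cases "x = ?d")
        case True
        then have h: "?h = Suc j" using j by (simp add: top_scale_def del: hist.simps)
        have "\<bar>x m - base (Suc j)\<bar> \<le> base j + real (Suc j) + 1"
          using bd base_ge_1[of j] unfolding h by linarith
        then have "\<bar>x m - base (Suc j)\<bar> / base (Suc j) \<le> r"
          unfolding r_def using pos j by (intro divide_right_mono) simp_all
        moreover have "\<bar>x m / base (Suc j) - 1\<bar> = \<bar>x m - base (Suc j)\<bar> / base (Suc j)"
          using pos j by (simp add: diff_divide_distrib[symmetric] abs_divide field_simps)
        ultimately show ?thesis using True j by simp
      next
        case False
        have "?h \<noteq> ?k" unfolding top_scale_def using n0[of "Suc m" x ?d] m x d False by simp
        then have h: "?h \<le> j" using dominant(2)[OF S(1,2) x, of m] j by linarith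
        have "0 \<le> x m" "x m \<le> base j + real (Suc j) + 1"
          using bd base_mono[OF h] h base_ge_1[of ?h] by linarith+
        then have "x m / base (Suc j) \<le> r" "0 \<le> x m / base (Suc j)"
          unfolding r_def using pos j by (intro divide_right_mono divide_nonneg_pos; simp)+
        then show ?thesis using False j by simp
      qed
    qed
    have "(\<Sum>x\<in>S. c x *\<^sub>R x) m / base ?k - c ?d
        = (\<Sum>x\<in>S. c x * (x m / base ?k - (if x = ?d then 1 else 0)))"
    proof -
      have "(\<Sum>x\<in>S. c x * (if x = ?d then 1 else 0)) = (\<Sum>x\<in>S. if x = ?d then c x else 0)"
        by (rule sum.cong) auto
      also have "\<dots> = c ?d" using S(1) d by simp
      finally show ?thesis
        by (simp only: sum_fun_apply scaleR_fun_def sum_divide_distrib right_diff_distrib sum_subtractf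
            times_divide_eq_right real_scaleR_def)
    qed
    also have "\<bar>\<dots>\<bar> \<le> (\<Sum>x\<in>S. \<bar>c x * (x m / base ?k - (if x = ?d then 1 else 0))\<bar>)" by (rule sum_abs)
    also have "\<dots> \<le> (\<Sum>x\<in>S. \<bar>c x\<bar> * r)"
      unfolding abs_mult by (intro sum_mono mult_left_mono err) auto
    also have "\<dots> = C * r" by (simp add: C_def sum_distrib_right)
    also have "\<dots> \<le> C * (3 / real (Suc m))"
    proof (rule mult_left_mono)
      have "r \<le> 3 / real (Suc j)" unfolding r_def by (rule base_ratio)
      also have "\<dots> \<le> 3 / real (Suc m)" using mj by (intro divide_left_mono) auto
      finally show "r \<le> 3 / real (Suc m)" .
      show "0 \<le> C" unfolding C_def by (intro sum_nonneg) auto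
    qed
    finally show ?thesis by simp
  qed
  then have "\<forall>\<^sub>F m in sequentially. norm ((\<Sum>x\<in>S. c x *\<^sub>R x) m / base (top_scale S m) - c (dominant S m))
      \<le> C * (3 / real (Suc m))"
    unfolding eventually_sequentially by blast
  moreover have "(\<lambda>m. C * (3 / real (Suc m))) \<longlonglongrightarrow> 0"
    using tendsto_mult_right_zero[OF LIMSEQ_Suc[OF lim_const_over_n[of 3]]] by simp
  ultimately show ?thesis by (rule Lim_null_comparison)
qed

text \<open>The moduli of the coefficients lie between two positive bounds. Eventually the quotient
  does too, and the widening window of \<open>scale_index_eqI\<close> then contains it.\<close>

lemma dominant_scale:
  assumes S: "finite S" "S \<noteq> {}" "S \<subseteq> coded_set" and c: "\<And>x. x \<in> S \<Longrightarrow> c x \<noteq> 0"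
  obtains d where "0 < d"
    "\<forall>\<^sub>F m in sequentially. d < \<bar>(\<Sum>x\<in>S. c x *\<^sub>R x) m / base (top_scale S m)\<bar>"
    "\<forall>\<^sub>F m in sequentially. scale_index ((\<Sum>x\<in>S. c x *\<^sub>R x) m) = top_scale S m"
proof -
  let ?q = "\<lambda>m. (\<Sum>x\<in>S. c x *\<^sub>R x) m / base (top_scale S m)"
  \<comment> \<open>With half the least modulus, an error below \<open>d\<close> keeps the quotient
    above \<open>d\<close>.\<close>
  define d where "d = Min ((\<lambda>x. \<bar>c x\<bar>) ` S) / 2"
  define D where "D = Max ((\<lambda>x. \<bar>c x\<bar>) ` S) + d"
  have d: "0 < d" unfolding d_def using S(1,2) c by (subst zero_less_divide_iff) (simp add: Min_gr_iff)
  have cb: "2 * d \<le> \<bar>c x\<bar>" "\<bar>c x\<bar> \<le> D - d" if "x \<in> S" for x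
    using that S(1) by (simp_all add: d_def D_def)
  have "\<forall>\<^sub>F m in sequentially. \<bar>?q m - c (dominant S m)\<bar> < d"
    using tendstoD[OF dominant_asymptotics[OF S, of c] d] by (simp add: dist_real_def)
  then have ev: "\<forall>\<^sub>F m in sequentially. d < \<bar>?q m\<bar> \<and> \<bar>?q m\<bar> \<le> D"
  proof eventually_elim
    case (elim m)
    then show ?case using cb[OF dominant(1)[OF S(1,2)], of m] by linarith
  qed
  have "\<forall>\<^sub>F m in sequentially. scale_index ((\<Sum>x\<in>S. c x *\<^sub>R x) m) = top_scale S m"
  proof -
    obtain N1 where N1: "D < real N1" using reals_Archimedean2 by blast
    obtain N2 where N2: "1 / d < real N2" using reals_Archimedean2 by blast
    show ?thesis using ev eventually_ge_at_top[of "max N1 N2"]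
    proof eventually_elim
      case (elim m)
      let ?k = "top_scale S m"
      have k: "m < ?k" by (rule top_scale_gt)
      have "1 / d < real ?k" "D \<le> real ?k + 1" using N1 N2 k elim(2) by auto
      then have "1 / real ?k < d" using d k by (simp add: field_simps)
      then show ?case using elim(1) \<open>D \<le> real ?k + 1\<close> k by (intro scale_index_eqI) linarith+
    qed
  qed
  then show ?thesis using that[OF d] ev by (simp add: eventually_conj_iff)
qed

lemma span_nonzero_coeffs:
  fixes z :: "'a::real_vector"
  assumes "z \<in> span B"
  shows "\<exists>T c. finite T \<and> T \<subseteq> B \<and> (\<forall>x\<in>T. c x \<noteq> 0) \<and> z = (\<Sum>x\<in>T. c x *\<^sub>R x)"
proof -
  from assms have "\<exists>S c. z = (\<Sum>x\<in>S. c x *\<^sub>R x) \<and> finite S \<and> S \<subseteq> B"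
    unfolding span_explicit mem_Collect_eq .
  then obtain S c where S: "finite S" "S \<subseteq> B" "z = (\<Sum>x\<in>S. c x *\<^sub>R x)" by metis
  have "z = (\<Sum>x\<in>{x\<in>S. c x \<noteq> 0}. c x *\<^sub>R x)"
    unfolding S(3) by (rule sum.mono_neutral_right) (use S(1) in auto)
  with S show ?thesis by (intro exI[of _ "{x\<in>S. c x \<noteq> 0}"] exI[of _ c]) auto
qed

text \<open>A nontrivial combination eventually exceeds a fixed positive multiple of
  \<open>base (top_scale T m)\<close> in modulus, and the scales tend to infinity.\<close>

lemma span_coded_unbounded:
  assumes "z \<in> span coded_set" "\<And>m. \<bar>z m\<bar> \<le> B"
  shows "z = 0"
proof (rule ccontr)
  assume "z \<noteq> 0"
  from span_nonzero_coeffs[OF assms(1)] obtain T c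
    where T: "finite T" "T \<subseteq> coded_set" and "\<forall>x\<in>T. c x \<noteq> 0" and z: "z = (\<Sum>x\<in>T. c x *\<^sub>R x)"
    by (elim exE conjE) (rule that)
  then have c: "c x \<noteq> 0" if "x \<in> T" for x using that by simp
  have "T \<noteq> {}"
  proof
    assume "T = {}"
    with z have "z = 0" by (simp only: sum.empty)
    with \<open>z \<noteq> 0\<close> show False ..
  qed
  obtain d where d: "0 < d" "\<forall>\<^sub>F m in sequentially. d < \<bar>z m / base (top_scale T m)\<bar>"
    unfolding z by (rule dominant_scale[OF T(1) \<open>T \<noteq> {}\<close> T(2) c])
  obtain N where N: "B / d < real N" using reals_Archimedean2 by blast
  obtain m where m: "N \<le> m" "d < \<bar>z m / base (top_scale T m)\<bar>"
    using eventually_happens'[OF sequentially_bot eventually_conj[OF eventually_ge_at_top[of N] d(2)]] by blast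
  let ?k = "top_scale T m"
  have "real ?k \<le> real (fact ?k)" unfolding of_nat_le_iff by (rule fact_ge_self)
  also have "\<dots> = fact ?k * 1" by simp
  also have "\<dots> \<le> fact ?k * fact ?k" by (intro mult_left_mono) (simp_all add: fact_ge_1)
  finally have "real ?k \<le> base ?k" by (simp add: base_def power2_eq_square)
  then have b: "real N \<le> base ?k" using m(1) top_scale_gt[of m T] by simp
  have "0 < base ?k" using base_ge_1[of ?k] by linarith
  then have "d * base ?k < \<bar>z m\<bar>" using m(2) by (simp add: abs_divide pos_less_divide_eq)
  moreover have "d * real N \<le> d * base ?k" using b d(1) by simp
  moreover have "B < d * real N" using N d(1) by (simp add: pos_divide_less_eq mult.commute)
  ultimately show False using assms(2)[of m] by linarith
qed

text \<open>A summand of a linear combination is labelled by \<open>(n, v)\<close>, where \<open>v\<close> is the number of the initial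
  segment of length \<open>n\<close> of its code. Holding the last value seen at a coordinate that the labelled
  summand dominates turns a limit along these coordinates into an ordinary one.\<close>

definition extends :: "nat \<Rightarrow> nat \<Rightarrow> nat \<Rightarrow> nat \<Rightarrow> bool" where
  "extends n v m k \<longleftrightarrow> (\<exists>b. hist b (Suc m) = k \<and> hist b n = v)"

text \<open>Only the first \<open>Suc m\<close> digits are determined by a number \<open>k\<close>
  that occurs, and \<open>point_approx\<close> at \<open>Suc m\<close> reads no others.\<close>

definition digits :: "nat \<Rightarrow> nat \<Rightarrow> nat \<Rightarrow> nat" where
  "digits m k = (SOME b. hist b (Suc m) = k)"

definition leading_point :: "nat \<Rightarrow> nat \<Rightarrow> (nat \<Rightarrow> real) \<Rightarrow> nat \<Rightarrow> real" where
  "leading_point n v z i = lim (hold (\<lambda>m. extends n v m (scale_index (z m)))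
     (\<lambda>m. point_approx (digits m (scale_index (z m))) (Suc m) i))"

definition leading_coeff :: "nat \<Rightarrow> nat \<Rightarrow> (nat \<Rightarrow> real) \<Rightarrow> real" where
  "leading_coeff n v z = lim (hold (\<lambda>m. extends n v m (scale_index (z m)))
     (\<lambda>m. z m / base (scale_index (z m))))"

text \<open>Some summand dominates infinitely often. Its label separates it from the others and can
  be tested on \<open>z\<close>, because \<open>scale_index (z m)\<close> is eventually the top
  scale.\<close>

lemma leading_term:
  assumes S: "finite S" "S \<noteq> {}" "S \<subseteq> coded_set" and c: "\<And>x. x \<in> S \<Longrightarrow> c x \<noteq> 0"
    and z: "z = (\<Sum>x\<in>S. c x *\<^sub>R x)"
  obtains x n v where "x \<in> S" "leading_point n v z = x" "leading_coeff n v z = c x"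
proof -
  obtain n0 where n0: "\<And>n x y. n0 \<le> n \<Longrightarrow> x \<in> S \<Longrightarrow> y \<in> S \<Longrightarrow> x \<noteq> y \<Longrightarrow>
    hist (code_of x) n \<noteq> hist (code_of y) n"
    using eventually_hist_neq[OF S(1,3)] by metis
  have sc: "\<forall>\<^sub>F m in sequentially. scale_index (z m) = top_scale S m"
    unfolding z by (rule dominant_scale[OF S c]) auto
  \<comment> \<open>Pigeonhole: if each element of the finite set dominated only finitely often,
    eventually none would dominate.\<close>
  have "\<exists>x\<in>S. \<exists>\<^sub>\<infinity>m. dominant S m = x"
  proof (rule ccontr)
    assume "\<not> ?thesis"
    then have "\<forall>\<^sub>F m in sequentially. \<forall>x\<in>S. dominant S m \<noteq> x"
      by (intro eventually_ball_finite S(1)) (simp add: frequently_def cofinite_eq_sequentially)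
    then obtain m where "\<forall>x\<in>S. dominant S m \<noteq> x" unfolding eventually_sequentially by blast
    then show False using dominant(1)[OF S(1,2)] by blast
  qed
  then obtain x where x: "x \<in> S" and inf: "\<exists>\<^sub>\<infinity>m. dominant S m = x" by blast
  have cx: "codes (code_of x) x" using codes_code_of S(3) x by blast
  define v where "v = hist (code_of x) n0"
  let ?P = "\<lambda>m. extends n0 v m (scale_index (z m))"
  \<comment> \<open>Eventually the test, computed from \<open>z\<close> alone, selects exactly the
    coordinates that \<open>x\<close> dominates.\<close>
  have P: "\<forall>\<^sub>F m in sequentially. scale_index (z m) = top_scale S m \<and> (?P m \<longleftrightarrow> dominant S m = x)"
    using sc eventually_ge_at_top[of n0]
  proof eventually_elim
    case (elim m)
    have "dominant S m = x" if "?P m"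
    proof -
      from that obtain b where b: "hist b (Suc m) = top_scale S m" "hist b n0 = v"
        unfolding extends_def elim(1) by blast
      then have "hist (code_of (dominant S m)) n0 = hist b n0"
        using hist_inj(2)[OF b(1)[unfolded top_scale_def]] elim(2) by (intro hist_cong) simp
      then show ?thesis using n0[of n0 "dominant S m" x] dominant(1)[OF S(1,2)] x b(2) v_def by auto
    qed
    moreover have "?P m" if "dominant S m = x"
      unfolding extends_def elim(1) top_scale_def that v_def by blast
    ultimately show ?case using elim(1) by blast
  qed
  have infP: "\<exists>\<^sub>\<infinity>m. ?P m"
  proof -
    have "\<exists>\<^sub>F m in sequentially. dominant S m = x" using inf by (simp add: cofinite_eq_sequentially)
    then have "\<exists>\<^sub>F m in sequentially. ?P m"
    proof (rule frequently_rev_mp)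
      show "\<forall>\<^sub>F m in sequentially. dominant S m = x \<longrightarrow> ?P m"
        using P by (rule eventually_mono) blast
    qed
    then show ?thesis by (simp add: cofinite_eq_sequentially)
  qed
  have "leading_point n0 v z i = x i" for i
    unfolding leading_point_def
  proof (intro limI hold_tendsto infP)
    fix e :: real assume "0 < e"
    have "\<forall>\<^sub>F m in sequentially. \<bar>point_approx (code_of x) (Suc m) i - x i\<bar> < e"
      using tendstoD[OF LIMSEQ_Suc[OF point_approx_tendsto[OF cx]] \<open>0 < e\<close>] by (simp add: dist_real_def)
    with P show "\<forall>\<^sub>F m in sequentially. ?P m \<longrightarrow>
      \<bar>point_approx (digits m (scale_index (z m))) (Suc m) i - x i\<bar> < e"
    proof eventually_elim
      case (elim m)
      show ?case
      proof
        assume "?P m"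
        then have "dominant S m = x" using elim(1) by blast
        then have "scale_index (z m) = hist (code_of x) (Suc m)" using elim(1) unfolding top_scale_def by metis
        then have "hist (digits m (scale_index (z m))) (Suc m) = hist (code_of x) (Suc m)"
          unfolding digits_def by (metis (mono_tags, lifting) someI)
        from hist_inj(2)[OF this]
        have "point_approx (digits m (scale_index (z m))) (Suc m) i = point_approx (code_of x) (Suc m) i"
          by (intro point_approx_cong) blast
        then show "\<bar>point_approx (digits m (scale_index (z m))) (Suc m) i - x i\<bar> < e" using elim(2) by simp
      qed
    qed
  qed
  moreover have "leading_coeff n0 v z = c x"
    unfolding leading_coeff_def
  proof (intro limI hold_tendsto infP)
    fix e :: real assume "0 < e"
    from tendstoD[OF dominant_asymptotics[OF S, of c] this]
    have "\<forall>\<^sub>F m in sequentially. \<bar>z m / base (top_scale S m) - c (dominant S m)\<bar> < e"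
      by (simp add: dist_real_def z)
    with P show "\<forall>\<^sub>F m in sequentially. ?P m \<longrightarrow> \<bar>z m / base (scale_index (z m)) - c x\<bar> < e"
      by eventually_elim auto
  qed
  ultimately show ?thesis using that[OF x] by blast
qed

section \<open>Borel measurability of the span\<close>

primrec combos :: "nat \<Rightarrow> (nat \<Rightarrow> real) set" where
  "combos 0 = {0}"
| "combos (Suc J) = combos J \<union> (\<Union>n v. {z. leading_point n v z \<in> coded_set \<and>
     z - leading_coeff n v z *\<^sub>R leading_point n v z \<in> combos J})"

text \<open>The extracted point is tested for membership in \<open>coded_set\<close>, so adding back
  its multiple stays in the span, whatever \<open>lim\<close> returns where no limit exists.\<close>

lemma combos_subset_span: "combos J \<subseteq> span coded_set"
proof (induction J)
  case 0
  then show ?case by (simp add: span_zero)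
next
  case (Suc J)
  have "z \<in> span coded_set" if "leading_point n v z \<in> coded_set"
    "z - leading_coeff n v z *\<^sub>R leading_point n v z \<in> combos J" for z n v
    using span_add[OF subsetD[OF Suc that(2)] span_scale[OF span_base[OF that(1)], of "leading_coeff n v z"]]
    by simp
  with Suc show ?case by auto
qed

lemma sum_mem_combos:
  assumes "finite S" "S \<subseteq> coded_set" "\<And>x. x \<in> S \<Longrightarrow> c x \<noteq> 0"
  shows "(\<Sum>x\<in>S. c x *\<^sub>R x) \<in> combos (card S)"
  using assms
proof (induction "card S" arbitrary: S)
  case 0
  then show ?case by (simp add: zero_fun_def)
next
  case (Suc J)
  then have "S \<noteq> {}" by auto
  define z where "z = (\<Sum>x\<in>S. c x *\<^sub>R x)"
  obtain x n v where x: "x \<in> S" "leading_point n v z = x" "leading_coeff n v z = c x"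
    by (rule leading_term[OF Suc.prems(1) \<open>S \<noteq> {}\<close> Suc.prems(2,3) z_def])
  have "z - c x *\<^sub>R x = (\<Sum>x\<in>S - {x}. c x *\<^sub>R x)"
    unfolding z_def using Suc.prems(1) x(1) by (simp add: sum_diff1)
  also have "\<dots> \<in> combos (card (S - {x}))"
    using Suc.prems Suc.hyps(2) x(1) by (intro Suc.hyps(1)) auto
  also have "card (S - {x}) = J" using Suc.hyps(2) Suc.prems(1) x(1) by simp
  finally have "z - leading_coeff n v z *\<^sub>R leading_point n v z \<in> combos J" by (simp only: x)
  moreover have "leading_point n v z \<in> coded_set" using x(1) Suc.prems(2) unfolding x(2) by (rule subsetD[rotated])
  ultimately have "z \<in> combos (Suc J)"
    unfolding combos.simps by (intro UnI2 UN_I[OF UNIV_I] CollectI conjI)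
  then show ?case unfolding z_def Suc.hyps(2) .
qed

lemma span_coded_eq: "span coded_set = (\<Union>J. combos J)"
proof
  show "span coded_set \<subseteq> (\<Union>J. combos J)"
  proof
    fix z assume "z \<in> span coded_set"
    from span_nonzero_coeffs[OF this] obtain T c
      where T: "finite T" "T \<subseteq> coded_set" "\<forall>x\<in>T. c x \<noteq> 0" "z = (\<Sum>x\<in>T. c x *\<^sub>R x)"
      by (elim exE conjE) (rule that)
    have "z \<in> combos (card T)" unfolding T(4) by (rule sum_mem_combos) (use T in simp_all)
    then show "z \<in> (\<Union>J. combos J)" by (rule UN_I[OF UNIV_I])
  qed
qed (use combos_subset_span in blast)

lemma measurable_component [measurable]: "(\<lambda>z::nat \<Rightarrow> real. z i) \<in> borel_measurable borel"
  by (intro borel_measurable_continuous_onI) simp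

lemma measurable_scale_index [measurable]: "scale_index \<in> borel \<rightarrow>\<^sub>M count_space UNIV"
  unfolding scale_index_def[abs_def] by measurable

lemma borel_measurable_hold:
  assumes "\<And>m. Measurable.pred M (\<lambda>z. P z m)" "\<And>m. (\<lambda>z. a z m) \<in> borel_measurable M"
  shows "(\<lambda>z. hold (P z) (a z) n) \<in> borel_measurable M"
  using assms by (induction n) simp_all

lemma measurable_leading_point: "leading_point n v \<in> borel_measurable borel"
proof (rule measurable_coordinatewise_then_product)
  fix i
  have "(\<lambda>z::nat \<Rightarrow> real. hold (\<lambda>m. extends n v m (scale_index (z m)))
      (\<lambda>m. point_approx (digits m (scale_index (z m))) (Suc m) i) k) \<in> borel_measurable borel" for k
  proof (rule borel_measurable_hold)
    fix m
    show "Measurable.pred borel (\<lambda>z::nat \<Rightarrow> real. extends n v m (scale_index (z m)))"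
      \<comment> \<open>\<open>scale_index\<close> takes values in a discrete space, on which every
        function is measurable.\<close>
      by (rule measurable_compose[of "\<lambda>z. scale_index (z m)" _ "count_space UNIV"]) measurable
    show "(\<lambda>z::nat \<Rightarrow> real. point_approx (digits m (scale_index (z m))) (Suc m) i) \<in> borel_measurable borel"
      by (rule measurable_compose[of "\<lambda>z. scale_index (z m)" _ "count_space UNIV"]) measurable
  qed
  then show "(\<lambda>z. leading_point n v z i) \<in> borel_measurable borel"
    unfolding leading_point_def by (rule borel_measurable_lim_metric)
qed

lemma measurable_leading_coeff [measurable]: "leading_coeff n v \<in> borel_measurable borel"
proof -
  have "(\<lambda>z::nat \<Rightarrow> real. hold (\<lambda>m. extends n v m (scale_index (z m)))
      (\<lambda>m. z m / base (scale_index (z m))) k) \<in> borel_measurable borel" for k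
  proof (rule borel_measurable_hold)
    fix m
    show "Measurable.pred borel (\<lambda>z::nat \<Rightarrow> real. extends n v m (scale_index (z m)))"
      by (rule measurable_compose[of "\<lambda>z. scale_index (z m)" _ "count_space UNIV"]) measurable
    have "(\<lambda>z::nat \<Rightarrow> real. base (scale_index (z m))) \<in> borel_measurable borel"
      by (rule measurable_compose[of "\<lambda>z. scale_index (z m)" _ "count_space UNIV"]) measurable
    then show "(\<lambda>z::nat \<Rightarrow> real. z m / base (scale_index (z m))) \<in> borel_measurable borel"
      by measurable
  qed
  then show ?thesis
    unfolding leading_coeff_def[abs_def] by (rule borel_measurable_lim_metric)
qed

lemma combos_borel: "combos J \<in> sets borel"
proof (induction J)
  case 0
  then show ?case by simp
next
  case (Suc J)
  have "{z. leading_point n v z \<in> coded_set \<and>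
     z - leading_coeff n v z *\<^sub>R leading_point n v z \<in> combos J} \<in> sets borel" for n v
  proof -
    have [measurable]: "(\<lambda>z. leading_point n v z i) \<in> borel_measurable borel" for i
      using measurable_compose[OF measurable_leading_point measurable_component] .
    have g: "(\<lambda>z. z - leading_coeff n v z *\<^sub>R leading_point n v z) \<in> borel_measurable borel"
      by (rule measurable_coordinatewise_then_product) (simp add: scaleR_fun_def)
    have "leading_point n v -` coded_set \<inter> (\<lambda>z. z - leading_coeff n v z *\<^sub>R leading_point n v z) -` combos J
      \<in> sets borel"
      using measurable_sets[OF measurable_leading_point coded_set_borel] measurable_sets[OF g Suc]
      by (intro sets.Int) simp_all
    also have "leading_point n v -` coded_set \<inter> (\<lambda>z. z - leading_coeff n v z *\<^sub>R leading_point n v z) -` combos J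
      = {z. leading_point n v z \<in> coded_set \<and> z - leading_coeff n v z *\<^sub>R leading_point n v z \<in> combos J}"
      by auto
    finally show ?thesis .
  qed
  then show ?case unfolding combos.simps by (intro sets.Un Suc sets.countable_UN') auto
qed

lemma span_coded_borel: "span coded_set \<in> sets borel"
  unfolding span_coded_eq by (intro sets.countable_UN') (auto simp: combos_borel)

section \<open>Closed covers of the coded sequences\<close>

text \<open>The demand for infinitely many odd digits is dropped here; the Baire argument recovers
  it by means of closed sets with empty interior.\<close>

definition coded_pairs :: "((nat \<Rightarrow> nat) \<times> (nat \<Rightarrow> real)) set" where
  "coded_pairs = {(b, x). \<forall>m. coded_at b x m}"

lemma open_prefix: "open {c :: nat \<Rightarrow> 'a::discrete_topology. \<forall>i<n. c i = b i}"
proof (rule open_Collect_all_less)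
  fix i
  have "open ((\<lambda>c::nat \<Rightarrow> 'a. c i) -` {b i})"
    by (intro open_vimage) (simp_all add: open_discrete)
  then show "open {c. c i = b i}" by (simp add: vimage_def)
qed

text \<open>The condition at \<open>m\<close> involves finitely many digits and is open in the
  point, so the pairs form a G-delta set in a completely metrizable product.\<close>

lemma completely_metrizable_coded_pairs: "completely_metrizable_space (top_of_set coded_pairs)"
proof -
  have "open {(b, x). coded_at b x m}" for m
  proof -
    have "{(b, x). coded_at b x m} = (\<Union>c. {b. \<forall>i<Suc m. b i = c i} \<times> {x. coded_at c x m})"
    proof (intro set_eqI iffI)
      fix p assume "p \<in> {(b, x). coded_at b x m}"
      then show "p \<in> (\<Union>c. {b. \<forall>i<Suc m. b i = c i} \<times> {x. coded_at c x m})"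
        by (intro UN_I[of "fst p"]) auto
    next
      fix p assume "p \<in> (\<Union>c. {b. \<forall>i<Suc m. b i = c i} \<times> {x. coded_at c x m})"
      then obtain c where c: "\<And>i. i \<le> m \<Longrightarrow> fst p i = c i" "coded_at c (snd p) m"
        by (auto simp: less_Suc_eq_le)
      then show "p \<in> {(b, x). coded_at b x m}"
        using coded_at_cong[of m "fst p" c "snd p"] by (simp add: case_prod_unfold)
    qed
    also have "open \<dots>" by (intro open_UN ballI open_Times open_prefix open_coded_at)
    finally show ?thesis .
  qed
  then have "gdelta_in euclidean (\<Inter>m. {(b, x). coded_at b x m})"
    by (intro gdelta_in_Inter) (auto intro!: open_imp_gdelta_in simp only: open_openin)
  also have "(\<Inter>m. {(b, x). coded_at b x m}) = coded_pairs" by (auto simp: coded_pairs_def)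
  finally have gd: "gdelta_in euclidean coded_pairs" .
  have "(euclidean :: nat topology) = discrete_topology UNIV"
    by (simp add: topology_eq open_discrete)
  then have "completely_metrizable_space (euclidean :: nat topology)"
    by (simp add: completely_metrizable_space_discrete_topology)
  then have "completely_metrizable_space (euclidean :: (nat \<Rightarrow> nat) topology)"
    unfolding euclidean_product_topology[symmetric] completely_metrizable_space_product_topology by simp
  moreover have "completely_metrizable_space (euclidean :: (nat \<Rightarrow> real) topology)"
    by (rule completely_metrizable_space_euclidean)
  ultimately have "completely_metrizable_space (euclidean :: ((nat \<Rightarrow> nat) \<times> (nat \<Rightarrow> real)) topology)"
    unfolding prod_topology_euclidean[symmetric] completely_metrizable_space_prod_topology by simp
  from completely_metrizable_space_gdelta_in[OF this gd] show ?thesis .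
qed

lemma coded_pairs_nonempty: "coded_pairs \<noteq> {}"
proof -
  have "(\<lambda>_. 0, \<lambda>m. base (hist (\<lambda>_. 0) (Suc m)) + 1 / 2) \<in> coded_pairs"
    by (simp add: coded_pairs_def coded_at_def cell_def add_pos_nonneg del: hist.simps)
  then show ?thesis by blast
qed

lemma mid_cell: "base k + 1 / 2 \<in> cell k"
  by (simp add: cell_def)

text \<open>A basic neighbourhood inside \<open>W\<close> restricts only finitely many digits and
  coordinates; past them a code can be continued at will.\<close>

lemma open_coded_pairs_odd:
  assumes W: "open W" and bx: "(b, x) \<in> W \<inter> coded_pairs"
  shows "\<exists>(c, y) \<in> W \<inter> coded_pairs. \<exists>m\<ge>p. odd (c m)"
proof -
  from W bx obtain U V where UV: "open U" "open V" "b \<in> U" "x \<in> V" "U \<times> V \<subseteq> W"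
    by (metis IntD1 open_prod_elim mem_Times_iff fst_conv snd_conv)
  obtain X n where X: "\<And>i. b i \<in> X i" "\<And>c. (\<And>i. i < n \<Longrightarrow> c i \<in> X i) \<Longrightarrow> c \<in> U"
    by (rule open_nat_fun_contains_box[OF UV(1,3)]) blast
  obtain Y n' where Y: "\<And>i. x i \<in> Y i" "\<And>c. (\<And>i. i < n' \<Longrightarrow> c i \<in> Y i) \<Longrightarrow> c \<in> V"
    by (rule open_nat_fun_contains_box[OF UV(2,4)]) blast
  define N where "N = Max {n, n', p}"
  have N: "n \<le> N" "n' \<le> N" "p \<le> N" by (simp_all add: N_def)
  obtain a where a: "\<And>i. i < N \<Longrightarrow> \<bar>x i - approx a i\<bar> < 1 / real (Suc N)"
    by (rule approx_dense[of "1 / real (Suc N)" N x]) auto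
  \<comment> \<open>\<open>Suc (2 * a)\<close> is odd and its half is the list code
    \<open>a\<close>; the zeros after it are even and demand no approximation.\<close>
  define c where "c m = (if m < N then b m else if m = N then Suc (2 * a) else 0)" for m
  define y where "y m = (if m < N then x m else base (hist c (Suc m)) + 1 / 2)" for m
  have "coded_at c y m" for m
  proof -
    consider "m < N" | "m = N" | "N < m" by linarith
    then show ?thesis
    proof cases
      case 1
      then have "coded_at c y m \<longleftrightarrow> coded_at b x m"
        using hist_cong[of "Suc m" c b] unfolding coded_at_def
        by (simp add: c_def y_def del: hist.simps)
      then show ?thesis using bx by (simp add: coded_pairs_def)
    next
      case 2
      have "c N div 2 = a" by (simp add: c_def)
      with 2 show ?thesis using a mid_cell unfolding coded_at_def
        by (simp add: y_def del: hist.simps)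
    next
      case 3
      then show ?thesis using mid_cell unfolding coded_at_def
        by (simp add: y_def c_def del: hist.simps)
    qed
  qed
  moreover have "c \<in> U" by (rule X(2)) (use X(1) N in \<open>simp add: c_def\<close>)
  moreover have "y \<in> V" by (rule Y(2)) (use Y(1) N in \<open>simp add: y_def\<close>)
  moreover have "odd (c N)" by (simp add: c_def)
  ultimately show ?thesis using UV(5) N(3)
    by (intro bexI[of _ "(c, y)"]) (auto simp: coded_pairs_def)
qed

text \<open>Past \<open>N\<close>, a translation fits the compact image of \<open>f\<close>
  coordinatewise into the cells of a suitable code; below \<open>N\<close>, continuity keeps an open
  set of arguments in the given box. These arguments are all mapped into one translate of
  \<open>F\<close>.\<close>

lemma not_haar_meager_if_open_coded_pairs:
  assumes W: "open W" and bx: "(b, x) \<in> W \<inter> coded_pairs"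
    and F: "\<And>c y. (c, y) \<in> W \<inter> coded_pairs \<Longrightarrow> y \<in> F"
  shows "\<not> haar_meager F"
proof
  assume "haar_meager F"
  then obtain f :: "cantor \<Rightarrow> nat \<Rightarrow> real" where f: "continuous_on UNIV f"
    and mg: "\<And>t. meager (f -` translate F t)"
    unfolding haar_meager_def by metis
  from W bx obtain U V where UV: "open U" "open V" "b \<in> U" "x \<in> V" "U \<times> V \<subseteq> W"
    by (metis IntD1 open_prod_elim mem_Times_iff fst_conv snd_conv)
  obtain X n where X: "\<And>i. b i \<in> X i" "\<And>c. (\<And>i. i < n \<Longrightarrow> c i \<in> X i) \<Longrightarrow> c \<in> U"
    by (rule open_nat_fun_contains_box[OF UV(1,3)]) blast
  obtain Y n' where Y: "\<And>i. open (Y i)" "\<And>i. x i \<in> Y i" "\<And>c. (\<And>i. i < n' \<Longrightarrow> c i \<in> Y i) \<Longrightarrow> c \<in> V"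
    by (rule open_nat_fun_contains_box[OF UV(2,4)]) blast
  define N where "N = max n n'"
  have N: "n \<le> N" "n' \<le> N" by (simp_all add: N_def)
  have "open {y. \<forall>m<N. coded_at b y m}" by (intro open_Collect_all_less open_coded_at)
  moreover have "x \<in> {y. \<forall>m<N. coded_at b y m}" using bx by (simp add: coded_pairs_def)
  ultimately obtain Z n'' where Z: "\<And>i. open (Z i)" "\<And>i. x i \<in> Z i"
    "\<And>y. (\<And>i. i < n'' \<Longrightarrow> y i \<in> Z i) \<Longrightarrow> y \<in> {y. \<forall>m<N. coded_at b y m}"
    by (rule open_nat_fun_contains_box) blast
  have fi: "continuous_on UNIV (\<lambda>\<xi>. f \<xi> i)" for i using f unfolding continuous_on_fun_iff by blast
  have "\<exists>w. \<forall>\<xi>. \<bar>f \<xi> i\<bar> \<le> real w" for i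
  proof -
    have "bounded (range (\<lambda>\<xi>. f \<xi> i))"
      by (intro compact_imp_bounded compact_continuous_image fi compact_UNIV_cantor)
    then obtain B where B: "\<And>\<xi>. \<bar>f \<xi> i\<bar> \<le> B" unfolding bounded_iff by auto
    obtain w where "B \<le> real w" using real_arch_simple by blast
    then show ?thesis using B order_trans by blast
  qed
  then obtain w where w: "\<And>i \<xi>. \<bar>f \<xi> i\<bar> \<le> real (w i)" by metis
  define \<xi>\<^sub>0 :: cantor where "\<xi>\<^sub>0 = (\<lambda>_. False)"
  \<comment> \<open>An even digit demands no approximation, and \<open>2 * w m\<close> makes the
    cell longer than the range of \<open>f\<close> at coordinate \<open>m\<close>.\<close>
  define c where "c m = (if m < N then b m else 2 * w m)" for m
  \<comment> \<open>Subtracting \<open>t\<close> sends \<open>f \<xi>\<^sub>0\<close> to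
    \<open>x\<close> below \<open>N\<close> and shifts the interval from \<open>- w m\<close> to
    \<open>w m\<close> into the cell afterwards.\<close>
  define t where "t m = (if m < N then f \<xi>\<^sub>0 m - x m
    else - (base (hist c (Suc m)) + real (w m) + 1 / 2))" for m
  define Q where "Q = {\<xi>. \<forall>i<N. f \<xi> i - t i \<in> Y i \<inter> Z i}"
  have "open Q" unfolding Q_def
  proof (rule open_Collect_all_less)
    fix i
    have "continuous_on UNIV (\<lambda>\<xi>. f \<xi> i - t i)" by (intro continuous_intros fi)
    then have "open ((\<lambda>\<xi>. f \<xi> i - t i) -` (Y i \<inter> Z i))" using Y(1) Z(1) by (intro open_vimage open_Int)
    then show "open {\<xi>. f \<xi> i - t i \<in> Y i \<inter> Z i}" by (simp add: vimage_def)
  qed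
  moreover have "\<xi>\<^sub>0 \<in> Q" using Y(2) Z(2) by (simp add: Q_def t_def)
  moreover have "Q \<subseteq> f -` translate F t"
  proof
    fix \<xi> assume \<xi>: "\<xi> \<in> Q"
    define y where "y = f \<xi> - t"
    have "coded_at c y m" for m
    proof (cases "m < N")
      case True
      \<comment> \<open>The box \<open>Z\<close> may restrict coordinates from \<open>N\<close> on;
        there \<open>y'\<close> takes the values of \<open>x\<close>, which does not affect the
        condition at \<open>m < N\<close>.\<close>
      define y' where "y' i = (if i < N then y i else x i)" for i
      have "y' i \<in> Z i" for i using \<xi> Z(2) by (auto simp: y'_def Q_def y_def)
      then have "coded_at b y' m" using Z(3)[of y'] True by blast
      moreover have "coded_at c y m \<longleftrightarrow> coded_at b y' m"
        using hist_cong[of "Suc m" c b] True unfolding coded_at_def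
        by (simp add: c_def y'_def del: hist.simps)
      ultimately show ?thesis by simp
    next
      case False
      let ?h = "hist c (Suc m)"
      have "2 * w m < ?h" using hist_Suc_gt(1)[of c m] False by (simp add: c_def del: hist.simps)
      then have "2 * real (w m) < real ?h" by linarith
      moreover have "y m = f \<xi> m + base ?h + real (w m) + 1 / 2" using False by (simp add: y_def t_def)
      ultimately have "y m \<in> cell ?h" using w[of \<xi> m] by (simp add: cell_def abs_le_iff del: hist.simps)
      then show ?thesis using False by (simp add: coded_at_def c_def)
    qed
    moreover have "c \<in> U" by (rule X(2)) (use X(1) N in \<open>simp add: c_def\<close>)
    moreover have "y \<in> V" by (rule Y(3)) (use \<xi> N in \<open>simp add: Q_def y_def\<close>)
    ultimately have "y \<in> F" using UV(5) by (intro F[of c]) (auto simp: coded_pairs_def)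
    then show "\<xi> \<in> f -` translate F t" by (simp add: mem_translate_iff y_def)
  qed
  ultimately show False using open_cantor_not_meager[of Q] meager_subset[OF mg] by auto
qed

text \<open>Baire's theorem in \<open>coded_pairs\<close>: the members of a cover pull back to
  closed sets, with empty interior by \<open>not_haar_meager_if_open_coded_pairs\<close>.\<close>

lemma coded_set_not_sigma_closed_HM: "coded_set \<notin> sigma_closed_HM"
proof
  assume "coded_set \<in> sigma_closed_HM"
  then have "\<exists>\<F>. countable \<F> \<and> (\<forall>F\<in>\<F>. closed F \<and> haar_meager F) \<and> coded_set \<subseteq> \<Union>\<F>"
    unfolding sigma_closed_HM_def mem_Collect_eq .
  then obtain \<F> where \<F>: "countable \<F>" "\<forall>F\<in>\<F>. closed F \<and> haar_meager F" "coded_set \<subseteq> \<Union>\<F>"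
    by (elim exE conjE) (rule that)
  let ?T = "top_of_set coded_pairs"
  \<comment> \<open>These sets absorb the pairs whose code has only finitely many odd digits;
    \<open>open_coded_pairs_odd\<close> gives them empty interior.\<close>
  define E where "E p = {(c::nat \<Rightarrow> nat, y::nat \<Rightarrow> real). \<forall>m\<ge>p. even (c m)}" for p :: nat
  define \<G> where "\<G> = (\<lambda>F. coded_pairs \<inter> snd -` F) ` \<F> \<union> range (\<lambda>p. coded_pairs \<inter> E p)"
  have closedE: "closed (E p)" for p
  proof -
    have "open {c::nat \<Rightarrow> nat. odd (c m)}" for m
    proof -
      have "open ((\<lambda>c::nat \<Rightarrow> nat. c m) -` {k. odd k})" by (intro open_vimage) (simp_all add: open_discrete)
      then show ?thesis by (simp add: vimage_def)
    qed
    then have "open (\<Union>m\<in>{p..}. {c::nat \<Rightarrow> nat. odd (c m)} \<times> (UNIV :: (nat \<Rightarrow> real) set))"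
      by (intro open_UN ballI open_Times) simp_all
    also have "(\<Union>m\<in>{p..}. {c::nat \<Rightarrow> nat. odd (c m)} \<times> (UNIV :: (nat \<Rightarrow> real) set)) = - E p"
      by (auto simp: E_def)
    finally show ?thesis by (simp add: closed_def)
  qed
  have "?T interior_of \<Union>\<G> = {}"
  proof (rule Baire_category_alt)
    show "completely_metrizable_space ?T \<or> locally_compact_space ?T \<and> regular_space ?T"
      using completely_metrizable_coded_pairs by blast
    show "countable \<G>" unfolding \<G>_def using \<F>(1) by simp
    fix C assume "C \<in> \<G>"
    have int: "?T interior_of C = {}"
      if *: "\<And>W b x. open W \<Longrightarrow> (b, x) \<in> W \<inter> coded_pairs \<Longrightarrow> W \<inter> coded_pairs \<subseteq> C \<Longrightarrow> False"
    proof (rule ccontr)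
      assume "?T interior_of C \<noteq> {}"
      then obtain b x where bx: "(b, x) \<in> ?T interior_of C" by auto
      then obtain S where S: "openin ?T S" "(b, x) \<in> S" "S \<subseteq> C" unfolding interior_of_def by blast
      then obtain W where W: "open W" "S = coded_pairs \<inter> W" unfolding openin_open by blast
      from *[OF W(1), of b x] S W(2) show False by blast
    qed
    from \<open>C \<in> \<G>\<close> consider F where "F \<in> \<F>" "C = coded_pairs \<inter> snd -` F" | p where "C = coded_pairs \<inter> E p"
      unfolding \<G>_def by blast
    then show "closedin ?T C \<and> ?T interior_of C = {}"
    proof cases
      case (1 F)
      have "closed (snd -` F :: ((nat \<Rightarrow> nat) \<times> (nat \<Rightarrow> real)) set)"
        using \<F>(2) 1(1) by (intro closed_vimage_snd) blast
      moreover have "?T interior_of C = {}"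
      proof (rule int)
        fix W :: "((nat \<Rightarrow> nat) \<times> (nat \<Rightarrow> real)) set" and b x
        assume "open W" "(b, x) \<in> W \<inter> coded_pairs" "W \<inter> coded_pairs \<subseteq> C"
        then have "\<not> haar_meager F"
          using 1(2) by (intro not_haar_meager_if_open_coded_pairs[of W b x]) auto
        then show False using \<F>(2) 1(1) by blast
      qed
      ultimately show ?thesis unfolding 1(2) closedin_closed by blast
    next
      case (2 p)
      have "?T interior_of C = {}"
      proof (rule int)
        fix W :: "((nat \<Rightarrow> nat) \<times> (nat \<Rightarrow> real)) set" and b x
        assume W: "open W" "(b, x) \<in> W \<inter> coded_pairs" "W \<inter> coded_pairs \<subseteq> C"
        from open_coded_pairs_odd[OF W(1,2), of p] W(3) show False
          unfolding 2 E_def by auto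
      qed
      then show ?thesis unfolding 2 closedin_closed using closedE by blast
    qed
  qed
  moreover have "coded_pairs \<subseteq> \<Union>\<G>"
  proof
    fix z assume z: "z \<in> coded_pairs"
    obtain b x where bx: "z = (b, x)" by (cases z)
    show "z \<in> \<Union>\<G>"
    proof (cases "\<exists>\<^sub>\<infinity>m. odd (b m)")
      case True
      then have "x \<in> coded_set" using z bx by (auto simp: coded_set_def codes_def coded_pairs_def)
      then obtain F where "F \<in> \<F>" "x \<in> F" using \<F>(3) by (meson UnionE subsetD)
      then show ?thesis using z bx by (intro UnionI[of "coded_pairs \<inter> snd -` F"]) (auto simp: \<G>_def)
    next
      case False
      then obtain p where "\<forall>m\<ge>p. even (b m)" unfolding INFM_nat_le by auto
      then show ?thesis using z bx by (intro UnionI[of "coded_pairs \<inter> E p"]) (auto simp: \<G>_def E_def)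
    qed
  qed
  then have "?T interior_of \<Union>\<G> = coded_pairs"
  proof -
    have "\<Union>\<G> \<subseteq> coded_pairs" by (auto simp: \<G>_def)
    with \<open>coded_pairs \<subseteq> \<Union>\<G>\<close> have "\<Union>\<G> = coded_pairs" by (rule subset_antisym[rotated])
    then show ?thesis using interior_of_topspace[of ?T] by simp
  qed
  ultimately show False using coded_pairs_nonempty by simp
qed

section \<open>Haar-thinness and null-finiteness of the span\<close>

lemma span_coded_diff_bounded:
  assumes "x \<in> span coded_set" "y \<in> span coded_set" "\<And>m. \<bar>x m - y m\<bar> \<le> B"
  shows "x = y"
  using span_coded_unbounded[OF span_diff[OF assms(1,2)], of B] assms(3) by simp

text \<open>Sequences of zeros and ones have bounded differences, so the preimage of a translate has
  at most one point.\<close>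

lemma span_coded_HT: "span coded_set \<in> HT"
proof -
  define f :: "cantor \<Rightarrow> nat \<Rightarrow> real" where "f \<xi> = (\<lambda>i. of_bool (\<xi> i))" for \<xi>
  have "continuous_on UNIV (\<lambda>\<xi>::cantor. of_bool (\<xi> i) :: real)" for i
    by (rule continuous_on_compose2[where g = "of_bool :: bool \<Rightarrow> real" and t = UNIV])
       (auto simp: continuous_on_discrete)
  then have f: "continuous_on UNIV f" unfolding continuous_on_fun_iff f_def by blast
  have "\<xi> = \<eta>" if "\<xi> \<in> f -` translate (span coded_set) t" "\<eta> \<in> f -` translate (span coded_set) t" for \<xi> \<eta> t
  proof -
    have "f \<xi> - t = f \<eta> - t"
      by (rule span_coded_diff_bounded[where B = 1])
         (use that in \<open>auto simp: mem_translate_iff f_def of_bool_def\<close>)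
    then have "f \<xi> i = f \<eta> i" for i by simp
    then show ?thesis by (auto simp: f_def fun_eq_iff of_bool_eq_iff)
  qed
  then have "thin (f -` translate (span coded_set) t)" for t
    unfolding thin_def by (intro allI inj_onI)
  then show ?thesis unfolding HT_def using f by (intro CollectI exI[of _ f] conjI allI)
qed

text \<open>The null sequence consists of constant sequences; their differences are bounded, so each
  translate meets the span at most once.\<close>

lemma span_coded_NF: "span coded_set \<in> NF"
proof -
  define u :: "nat \<Rightarrow> nat \<Rightarrow> real" where "u n = (\<lambda>_. 1 / real (Suc n))" for n
  have "u \<longlonglongrightarrow> 0"
    unfolding tendsto_fun_iff u_def using LIMSEQ_Suc[OF lim_1_over_n] by simp
  moreover have "finite {n. u n + x \<in> span coded_set}" for x
  proof -
    have "n = k" if "u n + x \<in> span coded_set" "u k + x \<in> span coded_set" for n k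
    proof -
      have "\<bar>1 / real (Suc n) - 1 / real (Suc k)\<bar> \<le> 1"
      proof -
        have "0 \<le> 1 / real (Suc j)" "1 / real (Suc j) \<le> 1" for j by simp_all
        from this[of n] this[of k] show ?thesis by linarith
      qed
      then have "u n + x = u k + x"
        by (intro span_coded_diff_bounded[where B = 1] that) (simp add: u_def)
      then have "u n 0 = u k 0" by simp
      then show ?thesis by (simp add: u_def)
    qed
    then have "{n. u n + x \<in> span coded_set} \<subseteq> {n. u n + x \<in> span coded_set \<and> (\<forall>k. u k + x \<in> span coded_set \<longrightarrow> n = k)}"
      by blast
    then show ?thesis
      by (metis (mono_tags, lifting) finite.simps finite_subset insertI1 mem_Collect_eq subsetI
          \<open>\<And>n k. u n + x \<in> span coded_set \<Longrightarrow> u k + x \<in> span coded_set \<Longrightarrow> n = k\<close>)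
  qed
  ultimately show ?thesis unfolding NF_def by (intro CollectI exI[of _ u] conjI allI)
qed

text \<open>A linear functional that vanishes on the span and on the dense space \<open>E\<close>,
  but not at the constant 1, is bounded on the span and discontinuous.\<close>

lemma span_coded_not_additive_bounding: "span coded_set \<notin> additive_bounding"
proof
  assume ab: "span coded_set \<in> additive_bounding"
  define E :: "(nat \<Rightarrow> real) set" where "E = {e. finite {i. e i \<noteq> 0}}"
  define W where "W = span (coded_set \<union> E)"
  define one :: "nat \<Rightarrow> real" where "one = (\<lambda>_. 1)"
  have "subspace E"
  proof (rule subspaceI)
    show "0 \<in> E" by (simp add: E_def)
    fix x y assume "x \<in> E" "y \<in> E"
    then have "finite ({i. x i \<noteq> 0} \<union> {i. y i \<noteq> 0})" by (simp add: E_def)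
    then show "x + y \<in> E" unfolding E_def mem_Collect_eq by (rule rev_finite_subset) auto
  next
    fix x and a :: real assume "x \<in> E"
    then have "finite {i. x i \<noteq> 0}" by (simp add: E_def)
    then show "a *\<^sub>R x \<in> E" unfolding E_def mem_Collect_eq
      by (rule rev_finite_subset) (auto simp: scaleR_fun_def)
  qed
  then have "span E = E" by (simp add: span_eq_iff)
  have "one \<notin> W"
  proof
    assume "one \<in> W"
    then obtain l e where le: "one = l + e" "l \<in> span coded_set" "e \<in> span E"
      unfolding W_def span_Un by blast
    then have "e \<in> E" using \<open>span E = E\<close> by simp
    then have e: "finite {i. e i \<noteq> 0}" by (simp add: E_def)
    have l: "l m = 1 - e m" for m using arg_cong[OF le(1), of "\<lambda>x. x m"] by (simp add: one_def)
    \<comment> \<open>Off the finite support of \<open>e\<close> the value of \<open>l\<close> is 1,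
      so \<open>l\<close> is bounded.\<close>
    define B where "B = Max (insert 1 ((\<lambda>i. \<bar>1 - e i\<bar>) ` {i. e i \<noteq> 0}))"
    have "\<bar>l m\<bar> \<le> B" for m
      unfolding l B_def by (cases "e m = 0") (auto intro!: Max_ge simp: e)
    then have "l = 0" using span_coded_unbounded[OF le(2)] by blast
    then have "e i = 1" for i using l[of i] by simp
    with e show False by simp
  qed
  obtain B where B: "B \<subseteq> W" "independent B" "W \<subseteq> span B"
    by (rule maximal_independent_subset[of W])
  have "span B = W"
    using span_minimal[OF B(1)] B(3) by (intro subset_antisym) (simp_all add: W_def subspace_span)
  with \<open>one \<notin> W\<close> have "independent (insert one B)" using B(2) by (simp add: independent_insertI)
  from linear_independent_extend[OF this, of "\<lambda>x. if x = one then 1 else 0 :: real"]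
  obtain g :: "(nat \<Rightarrow> real) \<Rightarrow> real" where g: "linear g" "\<forall>x\<in>insert one B. g x = (if x = one then 1 else 0)"
    by metis
  have "one \<notin> B" using \<open>one \<notin> W\<close> B(1) by blast
  then have "g x = 0" if "x \<in> B" for x using g(2) that by auto
  then have gW: "g x = 0" if "x \<in> W" for x
    using linear_eq_0_on_span[OF g(1), of B x] that \<open>span B = W\<close> by simp
  have "Modules.additive g" using g(1) by (simp add: Modules.additive_def linear_add)
  moreover have "g ` span coded_set \<subseteq> {0}" 
  proof (rule image_subsetI)
    fix x assume "x \<in> span coded_set"
    then have "x \<in> W" unfolding W_def using span_mono[of coded_set "coded_set \<union> E"] by auto
    then show "g x \<in> {0}" by (simp add: gW)
  qed
  then have "bounded (g ` span coded_set)" by (rule bounded_subset[rotated]) simp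
  ultimately have cont: "continuous_on UNIV g" using ab unfolding additive_bounding_def mem_Collect_eq by simp
  \<comment> \<open>The truncations of \<open>one\<close> lie in \<open>W\<close> and converge to it
    pointwise, so continuity would give \<open>g one = 0\<close>.\<close>
  define p where "p n = (\<lambda>i. if i < n then 1 else 0 :: real)" for n :: nat
  have "p \<longlonglongrightarrow> one"
    unfolding tendsto_fun_iff
  proof
    fix i
    have "\<forall>\<^sub>F n in sequentially. p n i = one i"
      using eventually_gt_at_top[of i] by eventually_elim (simp add: p_def one_def)
    then show "(\<lambda>n. p n i) \<longlonglongrightarrow> one i" by (rule tendsto_eventually)
  qed
  then have "(\<lambda>n. g (p n)) \<longlonglongrightarrow> g one"
    using cont by (intro continuous_on_tendsto_compose[OF cont]) auto
  moreover have "p n \<in> W" for n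
    unfolding W_def by (intro span_base UnI2) (simp add: E_def p_def)
  ultimately have "g one = 0" using gW LIMSEQ_const_iff[of 0 "g one"] by simp
  then show False using g(2) by simp
qed

lemma sigma_closed_HM_subset:
  assumes "A \<in> sigma_closed_HM" "B \<subseteq> A"
  shows "B \<in> sigma_closed_HM"
  using assms(1) unfolding sigma_closed_HM_def mem_Collect_eq
  by (elim exE conjE, intro exI conjI) (assumption, assumption, rule order_trans[OF assms(2)])

theorem theorem3:
  shows "\<exists>L :: (nat \<Rightarrow> real) set.
    subspace L \<and>
    L \<in> (Bor \<inter> HT \<inter> NF) - sigma_closed_HM \<and>
    ((Bor \<inter> HT \<inter> NF) - sigma_closed_HM :: (nat \<Rightarrow> real) set set)
      \<subseteq> (HN \<inter> HM) - sigma_closed_HN \<and>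
    L \<notin> additive_bounding"
proof (intro exI conjI)
  show "subspace (span coded_set)" by (rule subspace_span)
  have "span coded_set \<notin> sigma_closed_HM"
  proof
    assume "span coded_set \<in> sigma_closed_HM"
    then have "coded_set \<in> sigma_closed_HM"
      by (rule sigma_closed_HM_subset) (rule span_superset)
    then show False using coded_set_not_sigma_closed_HM by simp
  qed
  then show "span coded_set \<in> (Bor \<inter> HT \<inter> NF) - sigma_closed_HM"
    using span_coded_borel span_coded_HT span_coded_NF by (simp add: Bor_def)
  show "((Bor \<inter> HT \<inter> NF) - sigma_closed_HM :: (nat \<Rightarrow> real) set set) \<subseteq> (HN \<inter> HM) - sigma_closed_HN"
  proof
    fix A :: "(nat \<Rightarrow> real) set" assume A: "A \<in> (Bor \<inter> HT \<inter> NF) - sigma_closed_HM"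
    then have "A \<in> Bor \<inter> HT" by simp
    then have "A \<in> HN \<inter> HM" using Bor_HT_subset_HN_HM by (rule subsetD[rotated])
    moreover have "A \<notin> sigma_closed_HN" using A subsetD[OF sigma_closed_HN_subset_HM] by auto
    ultimately show "A \<in> (HN \<inter> HM) - sigma_closed_HN" by simp
  qed
  show "span coded_set \<notin> additive_bounding" by (rule span_coded_not_additive_bounding)
qed

end
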